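(* Let $(X,T)$ be a topological dynamical system satisfying the specification property, and let $\mathcal{F}=\{f_n\}_{n\ge1}$ and $\Phi=\{\varphi_n\}_{n\ge1}$ be two asymptotically additive potentials on $X$. Then for each $\alpha\in[\eta(\Phi),\beta(\Phi)]$, $$\Lambda_{\mathcal{F}\mid\Phi}(\alpha)=\sup_{x\in K_\Phi(\alpha)}\limsup_{n\to\infty}\frac1n f_n(x)=\sup\Big\{\mathcal{F}_*(\mu):\mu\in\bigcup_{x\in K_\Phi(\alpha)}\mathcal{V}(x)\Big\}.$$
   Context: $X$ is a compact metric space with metric $d$ and $T:X\to X$ is continuous. $\mathcal{M}_T$ denotes the set of $T$-invariant Borel probability measures on $X$. For $f\in C(X)$, $S_nf=\sum_{i=0}^{n-1}f\circ T^i$. A sequence $\mathcal{F}=\{f_n\}_{n\ge1}\subset C(X)$ is an asymptotically additive potential (AAP) if for every $\xi>0$ there is $f_\xi\in C(X)$ with $\limsup_{n\to\infty}\frac1n\|f_n-S_nf_\xi\|_\infty<\xi$; for $\mu\in\mathcal{M}_T$, $\mathcal{F}_*(\mu)=\lim_{n\to\infty}\frac1n\int f_n\,d\mu$ (this limit exists). $\beta(\Phi)=\max_{\mu\in\mathcal{M}_T}\Phi_*(\mu)$, $\eta(\Phi)=\min_{\mu\in\mathcal{M}_T}\Phi_*(\mu)$, $\Lambda_{\mathcal{F}\mid\Phi}(\alpha)=\sup\{\mathcal{F}_*(\mu):\mu\in\mathcal{M}_T,\ \Phi_*(\mu)=\alpha\}$. The level set is $K_\Phi(\alpha)=\{x\in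 X:\lim_{n\to\infty}\frac1n\varphi_n(x)=\alpha\}$. For $x\in X$, $\mathcal{V}(x)$ is the set of weak$^*$ limit points of the empirical measures $\delta_{x,n}=\frac1n\sum_{i=0}^{n-1}\delta_{T^ix}$. $(X,T)$ has the specification property if for every $\epsilon>0$ there is an integer $m(\epsilon)$ such that for any finite collection of intervals $[a_j,b_j]\subset\mathbb{N}$, $j=1,\dots,k$, with $a_{j+1}-b_j\ge m(\epsilon)$ for $j=1,\dots,k-1$, and any $x_1,\dots,x_k\in X$, there is $x\in X$ with $d(T^{p+a_j}x,T^px_j)<\epsilon$ for all $p=0,1,\dots,b_j-a_j$ and all $j=1,\dots,k$. *)

theory Defs
  imports "HOL-Probability.Probability"
begin

definition birk :: "('a \<Rightarrow> 'a) \<Rightarrow> ('a \<Rightarrow> real) \<Rightarrow> nat \<Rightarrow> 'a \<Rightarrow> real" where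
  "birk T g n x = (\<Sum>i<n. g ((T ^^ i) x))"

definition supnorm_on :: "'a set \<Rightarrow> ('a \<Rightarrow> real) \<Rightarrow> real" where
  "supnorm_on X h = Sup ((\<lambda>x. \<bar>h x\<bar>) ` X)"

text \<open>Asymptotically additive potential (sequence indexed by n >= 1; f 0 is irrelevant).\<close>
definition AAP :: "'a::metric_space set \<Rightarrow> ('a \<Rightarrow> 'a) \<Rightarrow> (nat \<Rightarrow> 'a \<Rightarrow> real) \<Rightarrow> bool" where
  "AAP X T f \<longleftrightarrow> (\<forall>n. continuous_on X (f n)) \<and>
     (\<forall>\<xi>>0. \<exists>g. continuous_on X g \<and>
        limsup (\<lambda>n. ereal (supnorm_on X (\<lambda>x. f n x - birk T g n x) / real n)) < ereal \<xi>)"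

definition inv_measures :: "'a::metric_space set \<Rightarrow> ('a \<Rightarrow> 'a) \<Rightarrow> 'a measure set" where
  "inv_measures X T = {M. prob_space M \<and> sets M = sets (restrict_space borel X)
                          \<and> T \<in> measurable M M \<and> distr M M T = M}"

definition Fstar :: "(nat \<Rightarrow> 'a \<Rightarrow> real) \<Rightarrow> 'a measure \<Rightarrow> real" where
  "Fstar f M = lim (\<lambda>n. integral\<^sup>L M (f n) / real n)"

definition beta_pot :: "'a::metric_space set \<Rightarrow> ('a \<Rightarrow> 'a) \<Rightarrow> (nat \<Rightarrow> 'a \<Rightarrow> real) \<Rightarrow> real" where
  "beta_pot X T \<phi> = Sup (Fstar \<phi> ` inv_measures X T)"

definition eta_pot :: "'a::metric_space set \<Rightarrow> ('a \<Rightarrow> 'a) \<Rightarrow> (nat \<Rightarrow> 'a \<Rightarrow> real) \<Rightarrow> real" where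
  "eta_pot X T \<phi> = Inf (Fstar \<phi> ` inv_measures X T)"

definition Lambda_cond :: "'a::metric_space set \<Rightarrow> ('a \<Rightarrow> 'a) \<Rightarrow> (nat \<Rightarrow> 'a \<Rightarrow> real)
    \<Rightarrow> (nat \<Rightarrow> 'a \<Rightarrow> real) \<Rightarrow> real \<Rightarrow> ereal" where
  "Lambda_cond X T f \<phi> \<alpha> = Sup {ereal (Fstar f M) | M. M \<in> inv_measures X T \<and> Fstar \<phi> M = \<alpha>}"

definition level_set :: "'a set \<Rightarrow> (nat \<Rightarrow> 'a \<Rightarrow> real) \<Rightarrow> real \<Rightarrow> 'a set" where
  "level_set X \<phi> \<alpha> = {x \<in> X. (\<lambda>n. \<phi> n x / real n) \<longlonglongrightarrow> \<alpha>}"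

text \<open>Weak* limit points of the empirical measures delta_{x,n}.\<close>
definition emp_limits :: "'a::metric_space set \<Rightarrow> ('a \<Rightarrow> 'a) \<Rightarrow> 'a \<Rightarrow> 'a measure set" where
  "emp_limits X T x = {M. prob_space M \<and> sets M = sets (restrict_space borel X) \<and>
     (\<exists>r. strict_mono r \<and> (\<forall>g. continuous_on X g \<longrightarrow>
        (\<lambda>k. birk T g (r k) x / real (r k)) \<longlonglongrightarrow> integral\<^sup>L M g))}"

definition has_specification :: "'a::metric_space set \<Rightarrow> ('a \<Rightarrow> 'a) \<Rightarrow> bool" where
  "has_specification X T \<longleftrightarrow> (\<forall>\<epsilon>>0. \<exists>m::nat. \<forall>(k::nat) (a::nat\<Rightarrow>nat) (b::nat\<Rightarrow>nat) xs.
     (\<forall>j<k. a j \<le> b j) \<and> (\<forall>j. Suc j < k \<longrightarrow> int (a (Suc j)) - int (b j) \<ge> int m) \<and>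
     (\<forall>j<k. xs j \<in> X) \<longrightarrow>
     (\<exists>x\<in>X. \<forall>j<k. \<forall>p\<le>b j - a j. dist ((T ^^ (p + a j)) x) ((T ^^ p) (xs j)) < \<epsilon>))"

end

theory Submission
  imports Defs
begin

text \<open>
  If \<open>x\<close> lies in the level set, every weak* limit point \<open>M\<close> of its empirical measures is invariant
  and, by uniform approximation of the potentials by Birkhoff sums, satisfies \<open>Fstar \<phi> M = \<alpha>\<close>; by
  weak* compactness the limsup of \<open>f n x / n\<close> is \<open>Fstar f M\<close> for one such \<open>M\<close>. Conversely, every
  invariant \<open>M\<close>, ergodic or not, has a generic point relative to any countable family of continuous functions:
  since \<open>M\<close> is the barycentre of its orbit averages of any fixed length, suitably chosen orbit
  segments have averages close to \<open>M\<close>, and specification glues them, with ever smaller errors,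
  along a single orbit. For a family approximating both potentials this point lies in the level set
  of \<open>Fstar \<phi> M\<close> and realises \<open>Fstar f M\<close>.
\<close>

section \<open>Weak* sequential compactness on compact metric spaces\<close>

text \<open>Specification glues only finitely many segments, at one fixed precision, and a fixed
  precision yields averages that are only nearly right. Hence stage \<open>k\<close> treats just the
  first \<open>k\<close> test functions, with tolerance \<open>(1/2)^k\<close>, and pays an overhead
  \<open>L k\<close> for gaps, for the imbalance of the chosen segments and for an unfinished block.
  As \<open>L k\<close> is known before any stage length, stage \<open>k\<close> can be made to
  start at a time large compared with \<open>L 0 + ... + L k\<close>. Single segments of a
  non-ergodic \<open>M\<close> may have quite wrong averages; only sums over many segments have to
  be right. A greedy choice keeps \<open>q\<close> centred segment values summing to order
  \<open>sqrt q\<close>, for finitely many functions at once, so no ergodic decomposition enters.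
  For compactness, \<open>X\<close> is coded into the line by a map that may be discontinuous. This
  is harmless because the measures being coded are discrete; only the decoding map, applied to the
  limit measure, has to be continuous.\<close>

definition ternary_code :: "(nat \<Rightarrow> bool) \<Rightarrow> real" where
  "ternary_code a = (\<Sum>k. of_bool (a k) * (1/3) ^ k)"

lemma summable_ternary: "summable (\<lambda>k. of_bool (a k) * (1/3::real) ^ k)"
  by (rule summable_comparison_test'[of "\<lambda>k. (1/3::real) ^ k" 0]) (auto intro: summable_geometric)

lemma ternary_code_bounds: "0 \<le> ternary_code a" "ternary_code a \<le> 3/2"
proof -
  show "0 \<le> ternary_code a"
    unfolding ternary_code_def by (intro suminf_nonneg summable_ternary) auto
  have "ternary_code a \<le> (\<Sum>k. (1/3::real) ^ k)"
    unfolding ternary_code_def by (intro suminf_le summable_ternary) (auto intro: summable_geometric)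
  also have "\<dots> = 3/2" by (subst suminf_geometric) auto
  finally show "ternary_code a \<le> 3/2" .
qed

text \<open>The first differing digit \<open>k0\<close> contributes \<open>(1/3)^k0\<close>, and all
  later digits together at most half of that, so half survives. Base 2 would leave no margin. Any
  differing index \<open>k\<close> satisfies \<open>k0 \<le> k\<close>, which only weakens the
  bound.\<close>

lemma ternary_code_gap:
  assumes "a k \<noteq> b k"
  shows "(1/3) ^ k / 2 \<le> \<bar>ternary_code a - ternary_code b\<bar>"
proof -
  define k0 where "k0 = (LEAST k. a k \<noteq> b k)"
  have k0: "a k0 \<noteq> b k0" "k0 \<le> k"
    unfolding k0_def using LeastI[of "\<lambda>k. a k \<noteq> b k"] Least_le[of "\<lambda>k. a k \<noteq> b k"] assms by auto
  have below: "a j = b j" if "j < k0" for j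
    using not_less_Least[of j "\<lambda>k. a k \<noteq> b k"] that unfolding k0_def by auto
  define d where "d j = of_bool (a j) * (1/3::real) ^ j - of_bool (b j) * (1/3) ^ j" for j
  have sum_d: "summable d" unfolding d_def by (intro summable_diff summable_ternary)
  have sum_tail: "summable (\<lambda>j. d (j + Suc k0))" using sum_d summable_iff_shift by blast
  have d_le: "\<bar>d j\<bar> \<le> (1/3) ^ j" for j unfolding d_def by auto
  have geo: "summable (\<lambda>j. (1/3::real) ^ (j + Suc k0))"
    by (subst summable_iff_shift) (auto intro: summable_geometric)
  have "ternary_code a - ternary_code b = suminf d"
    unfolding ternary_code_def d_def by (intro suminf_diff summable_ternary)
  also have "\<dots> = (\<Sum>j. d (j + Suc k0)) + (\<Sum>j<Suc k0. d j)"
    using suminf_split_initial_segment[OF sum_d] .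
  also have "(\<Sum>j<Suc k0. d j) = d k0"
    by (simp add: lessThan_Suc) (rule sum.neutral, auto simp: d_def below)
  finally have eq: "ternary_code a - ternary_code b = (\<Sum>j. d (j + Suc k0)) + d k0" .
  have abs_tail: "summable (\<lambda>j. \<bar>d (j + Suc k0)\<bar>)"
    by (rule summable_comparison_test'[OF geo, of 0]) (use d_le in \<open>simp del: add_Suc_right\<close>)
  have "\<bar>\<Sum>j. d (j + Suc k0)\<bar> \<le> (\<Sum>j. \<bar>d (j + Suc k0)\<bar>)"
    by (rule summable_rabs[OF abs_tail])
  also have "\<dots> \<le> (\<Sum>j. (1/3) ^ (j + Suc k0))"
    by (rule suminf_le[OF d_le abs_tail geo])
  also have "\<dots> = (\<Sum>j. (1/3) ^ Suc k0 * (1/3) ^ j)" by (simp add: power_add mult_ac)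
  also have "\<dots> = (1/3) ^ Suc k0 * (3/2)"
    by (subst suminf_mult) (auto intro: summable_geometric simp: suminf_geometric)
  finally have "\<bar>\<Sum>j. d (j + Suc k0)\<bar> \<le> (1/3) ^ k0 / 2" by simp
  moreover have "\<bar>d k0\<bar> = (1/3) ^ k0" using k0(1) by (auto simp: d_def)
  ultimately have "(1/3) ^ k0 / 2 \<le> \<bar>ternary_code a - ternary_code b\<bar>" using eq by linarith
  moreover have "(1/3::real) ^ k \<le> (1/3) ^ k0" using k0(2) by (intro power_decreasing) auto
  ultimately show ?thesis by linarith
qed

text \<open>The sets are the balls of finite \<open>1/(n+1)\<close>-nets, over all \<open>n\<close>.
  The finitely many balls of one net have bounded indices, so agreement up to \<open>K\<close> puts
  \<open>y\<close> into a net ball that contains \<open>x\<close>.\<close>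

lemma compact_separating_sequence:
  fixes X :: "'a::metric_space set"
  assumes "compact X"
  obtains A :: "nat \<Rightarrow> 'a set" where
    "\<And>\<epsilon>. \<epsilon> > 0 \<Longrightarrow> \<exists>K. \<forall>x\<in>X. \<forall>y\<in>X. (\<forall>k\<le>K. x \<in> A k \<longleftrightarrow> y \<in> A k) \<longrightarrow> dist x y < \<epsilon>"
proof -
  have "\<exists>F. finite F \<and> X \<subseteq> (\<Union>c\<in>F. ball c (1 / real (Suc n)))" for n
  proof -
    have "X \<subseteq> (\<Union>c\<in>X. ball c (1 / real (Suc n)))" by force
    from compactE_image[OF assms _ this] show ?thesis by (metis open_ball)
  qed
  then obtain F where F: "\<And>n. finite (F n)" "\<And>n. X \<subseteq> (\<Union>c\<in>F n. ball c (1 / real (Suc n)))"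
    by metis
  define \<A> where "\<A> = insert UNIV (\<Union>n. (\<lambda>c. ball c (1 / real (Suc n))) ` F n)"
  have cnt: "countable \<A>" unfolding \<A>_def using F(1) by (auto intro: countable_finite)
  define A where "A = from_nat_into \<A>"
  have idx: "\<exists>k. A k = S" if "S \<in> \<A>" for S
    using from_nat_into_surj[OF cnt that] unfolding A_def by blast
  show thesis
  proof (rule that)
    fix \<epsilon> :: real assume "\<epsilon> > 0"
    then obtain n where n: "1 / real (Suc n) < \<epsilon> / 2"
      using nat_approx_posE[of "\<epsilon>/2"] by (metis half_gt_zero)
    have "\<exists>k. A k = ball c (1 / real (Suc n))" if "c \<in> F n" for c
      using that by (intro idx) (auto simp: \<A>_def)
    then obtain i where i: "\<And>c. c \<in> F n \<Longrightarrow> A (i c) = ball c (1 / real (Suc n))" by metis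
    define K where "K = Max (i ` F n)"
    have "dist x y < \<epsilon>" if x: "x \<in> X" and y: "y \<in> X" and eq: "\<forall>k\<le>K. x \<in> A k \<longleftrightarrow> y \<in> A k" for x y
    proof -
      obtain c where c: "c \<in> F n" "x \<in> ball c (1 / real (Suc n))" using F(2) x by blast
      have "i c \<le> K" unfolding K_def using c(1) F(1) by auto
      then have "y \<in> ball c (1 / real (Suc n))" using eq c i by metis
      then show ?thesis using c n dist_triangle_half_r[of c x \<epsilon> y] by (auto simp del: of_nat_Suc)
    qed
    then show "\<exists>K. \<forall>x\<in>X. \<forall>y\<in>X. (\<forall>k\<le>K. x \<in> A k \<longleftrightarrow> y \<in> A k) \<longrightarrow> dist x y < \<epsilon>" by blast
  qed
qed

text \<open>\<open>X\<close> becomes a continuous image of a compact set of reals, with a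
  set-theoretic section \<open>h\<close>. Neither continuity nor measurability of \<open>h\<close>
  is claimed: it will only push forward measures of type \<open>pmf\<close>, for which every map is
  measurable.\<close>

lemma compact_real_coding:
  fixes X :: "'a::metric_space set"
  assumes "compact X"
  obtains C :: "real set" and \<pi> :: "real \<Rightarrow> 'a" and h :: "'a \<Rightarrow> real" where
    "compact C" "continuous_on C \<pi>" "\<pi> ` C \<subseteq> X" "h ` X \<subseteq> C" "\<And>x. x \<in> X \<Longrightarrow> \<pi> (h x) = x"
proof -
  obtain A :: "nat \<Rightarrow> 'a set" where A:
    "\<And>\<epsilon>. \<epsilon> > 0 \<Longrightarrow> \<exists>K. \<forall>x\<in>X. \<forall>y\<in>X. (\<forall>k\<le>K. x \<in> A k \<longleftrightarrow> y \<in> A k) \<longrightarrow> dist x y < \<epsilon>"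
    using compact_separating_sequence[OF assms] by blast
  define h where "h x = ternary_code (\<lambda>k. x \<in> A k)" for x
  have sep: "\<exists>\<delta>>0. \<forall>x\<in>X. \<forall>y\<in>X. \<bar>h x - h y\<bar> < \<delta> \<longrightarrow> dist x y < \<epsilon>" if "\<epsilon> > 0" for \<epsilon>
  proof -
    obtain K where K: "\<forall>x\<in>X. \<forall>y\<in>X. (\<forall>k\<le>K. x \<in> A k \<longleftrightarrow> y \<in> A k) \<longrightarrow> dist x y < \<epsilon>"
      using A[OF \<open>\<epsilon> > 0\<close>] by blast
    have "x \<in> A k \<longleftrightarrow> y \<in> A k" if "\<bar>h x - h y\<bar> < (1/3) ^ K / 2" "k \<le> K" for x y k
    proof (rule ccontr)
      assume "\<not> ?thesis"
      then have "(1/3) ^ k / 2 \<le> \<bar>h x - h y\<bar>"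
        unfolding h_def by (intro ternary_code_gap) auto
      moreover have "(1/3::real) ^ K \<le> (1/3) ^ k" using that(2) by (intro power_decreasing) auto
      ultimately show False using that(1) by linarith
    qed
    then show ?thesis using K by (intro exI[of _ "(1/3) ^ K / 2"]) auto
  qed
  txt \<open>\<open>h\<close> need not be continuous, but its inverse is uniformly continuous by \<open>sep\<close>; so the closure
    of its graph is still the graph of a continuous function of the first coordinate.\<close>
  define G where "G = (\<lambda>x. (h x, x)) ` X"
  define D where "D = closure G"
  have GD: "G \<subseteq> D" unfolding D_def by (rule closure_subset)
  have "D \<subseteq> {0..3/2} \<times> X"
    unfolding D_def G_def
    by (rule closure_minimal)
       (use ternary_code_bounds in \<open>auto simp: h_def intro: closed_Times compact_imp_closed[OF assms]
          simp del: le_divide_eq_numeral1\<close>)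
  then have DX: "snd p \<in> X" if "p \<in> D" for p using that by auto
  have "compact D"
    using compact_Int_closed[OF compact_Times[OF compact_Icc assms], of D 0 "3/2"]
      \<open>D \<subseteq> _\<close> unfolding D_def by (simp add: Int_absorb1)
  have approx: "\<exists>x\<in>X. \<bar>h x - fst p\<bar> < \<delta> \<and> dist x (snd p) < \<delta>" if "p \<in> D" "\<delta> > 0" for p \<delta>
  proof -
    obtain q where q: "q \<in> G" "dist q p < \<delta>"
      using \<open>p \<in> D\<close> \<open>\<delta> > 0\<close> unfolding D_def closure_approachable by blast
    have "dist (fst q) (fst p) < \<delta>" "dist (snd q) (snd p) < \<delta>"
      using q(2) dist_fst_le[of q p] dist_snd_le[of q p] by linarith+
    then show ?thesis using q(1) by (auto simp: G_def dist_real_def)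
  qed
  have inj: "inj_on fst D"
  proof (rule inj_onI, rule ccontr)
    fix p q assume p: "p \<in> D" and q: "q \<in> D" and eq: "fst p = fst q" and "p \<noteq> q"
    \<comment> \<open>A third, because the path from \<open>snd p\<close> to \<open>snd q\<close>
      through the graph points over \<open>x\<close> and \<open>y\<close> has three legs, each
      shorter than \<open>\<epsilon>\<close>.\<close>
    define \<epsilon> where "\<epsilon> = dist (snd p) (snd q) / 3"
    have "\<epsilon> > 0" using eq \<open>p \<noteq> q\<close> by (auto simp: \<epsilon>_def prod_eq_iff)
    then obtain \<delta> where \<delta>: "\<delta> > 0" "\<forall>x\<in>X. \<forall>y\<in>X. \<bar>h x - h y\<bar> < \<delta> \<longrightarrow> dist x y < \<epsilon>"
      using sep by blast
    define \<eta> where "\<eta> = min (\<delta>/2) \<epsilon>"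
    have "\<eta> > 0" using \<delta> \<open>\<epsilon> > 0\<close> by (auto simp: \<eta>_def)
    obtain x where x: "x \<in> X" "\<bar>h x - fst p\<bar> < \<eta>" "dist x (snd p) < \<eta>" using approx[OF p \<open>\<eta> > 0\<close>] by blast
    obtain y where y: "y \<in> X" "\<bar>h y - fst q\<bar> < \<eta>" "dist y (snd q) < \<eta>" using approx[OF q \<open>\<eta> > 0\<close>] by blast
    have "\<bar>h x - h y\<bar> < \<delta>" using x y eq unfolding \<eta>_def by linarith
    then have "dist x y < \<epsilon>" using \<delta> x y by blast
    moreover have "dist (snd p) (snd q) \<le> dist x (snd p) + dist x y + dist y (snd q)"
      using dist_triangle[of "snd p" "snd q" x] dist_triangle[of x "snd q" y]
      by (simp add: dist_commute)
    ultimately show False using x y \<open>\<epsilon> > 0\<close> unfolding \<eta>_def \<epsilon>_def by linarith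
  qed
  define \<pi> where "\<pi> = snd \<circ> the_inv_into D fst"
  have inv: "the_inv_into D fst (fst p) = p" if "p \<in> D" for p
    using the_inv_into_f_f[OF inj that] .
  show thesis
  proof (rule that)
    show "compact (fst ` D)" using \<open>compact D\<close> by (intro compact_continuous_image) (auto intro: continuous_intros)
    have "continuous_on (fst ` D) (the_inv_into D fst)"
      using \<open>compact D\<close> inv by (intro continuous_on_inv) (auto intro: continuous_intros)
    then show "continuous_on (fst ` D) \<pi>" unfolding \<pi>_def o_def by (intro continuous_intros)
    show "\<pi> ` fst ` D \<subseteq> X" using inv DX by (force simp: \<pi>_def)
    have *: "(h x, x) \<in> D" if "x \<in> X" for x using GD that by (auto simp: G_def)
    then show "h ` X \<subseteq> fst ` D" by force
    show "\<pi> (h x) = x" if "x \<in> X" for x using inv[OF *[OF that]] by (simp add: \<pi>_def)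
  qed
qed

text \<open>The measures are transported to the real line, where Helly's selection theorem applies.\<close>

lemma compact_weak_limit:
  fixes X :: "'a::metric_space set" and P :: "nat \<Rightarrow> 'a pmf"
  assumes "compact X" "\<And>n. set_pmf (P n) \<subseteq> X"
  obtains s M where "strict_mono s" "prob_space M" "sets M = sets (restrict_space borel X)"
    "\<And>g :: 'a \<Rightarrow> real. continuous_on X g \<Longrightarrow>
        (\<lambda>n. integral\<^sup>L (measure_pmf (P (s n))) g) \<longlonglongrightarrow> integral\<^sup>L M g"
proof -
  obtain C :: "real set" and \<pi> h where
    C: "compact C" and \<pi>: "continuous_on C \<pi>" "\<pi> ` C \<subseteq> X" and h: "h ` X \<subseteq> C" "\<And>x. x \<in> X \<Longrightarrow> \<pi> (h x) = x"
    using compact_real_coding[OF assms(1)] by blast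
  obtain x0 where x0: "x0 \<in> X" using assms(2)[of 0] set_pmf_not_empty[of "P 0"] by blast
  then have Cne: "C \<noteq> {}" using h by blast
  define \<mu> where "\<mu> n = distr (measure_pmf (P n)) borel h" for n
  have rd: "real_distribution (\<mu> n)" for n
    unfolding \<mu>_def real_distribution_def real_distribution_axioms_def
    by (auto intro: prob_space.prob_space_distr measure_pmf.prob_space_axioms)
  have int_\<mu>: "integral\<^sup>L (\<mu> n) u = (\<integral>x. u (h x) \<partial>measure_pmf (P n))"
    if "u \<in> borel_measurable borel" for n and u :: "real \<Rightarrow> real"
    unfolding \<mu>_def by (rule integral_distr) (use that in auto)
  have AEX: "AE x in measure_pmf (P n). x \<in> X" for n
    using assms(2) by (auto simp: AE_measure_pmf_iff)
  have "tight \<mu>"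
  proof -
    obtain B where B: "\<And>t. t \<in> C \<Longrightarrow> \<bar>t\<bar> \<le> B"
      using compact_imp_bounded[OF C] unfolding bounded_iff by (auto simp: real_norm_def)
    have "B \<ge> 0" using Cne B by fastforce
    have "measure (\<mu> n) {-B-1<..B} = 1" for n
    proof -
      interpret real_distribution "\<mu> n" by (rule rd)
      have "AE t in \<mu> n. t \<in> {-B-1<..B}"
        unfolding \<mu>_def
      proof (subst AE_distr_iff)
        show "AE x in measure_pmf (P n). h x \<in> {-B-1<..B}"
          using AEX
        proof eventually_elim
          case (elim x)
          then have "\<bar>h x\<bar> \<le> B" using B h by blast
          then show ?case by auto
        qed
      qed auto
      then show ?thesis by (subst prob_eq_1) auto
    qed
    then show ?thesis unfolding tight_def using rd \<open>B \<ge> 0\<close>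
      by (intro conjI allI impI exI[of _ "-B-1"] exI[of _ B]) auto
  qed
  from tight_imp_convergent_subsubsequence[OF this strict_mono_id]
  obtain s \<nu> where s: "strict_mono (s :: nat \<Rightarrow> nat)" and \<nu>: "real_distribution \<nu>"
    and conv: "weak_conv_m (\<lambda>n. \<mu> (s n)) \<nu>" by (auto simp: o_def)
  interpret \<nu>: real_distribution \<nu> by (rule \<nu>)
  have conv_int: "(\<lambda>n. \<integral>x. u (h x) \<partial>measure_pmf (P (s n))) \<longlonglongrightarrow> integral\<^sup>L \<nu> u"
    if u: "continuous_on UNIV u" "\<And>t. norm (u t) \<le> B" for u :: "real \<Rightarrow> real" and B
  proof -
    have m: "u \<in> borel_measurable borel" using u(1) by (rule borel_measurable_continuous_onI)
    have "(\<lambda>n. integral\<^sup>L (\<mu> (s n)) u) \<longlonglongrightarrow> integral\<^sup>L \<nu> u"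
      by (rule weak_conv_imp_integral_bdd_continuous_conv[OF rd \<nu> conv])
         (use u in \<open>auto simp: continuous_on_eq_continuous_at\<close>)
    then show ?thesis by (simp add: int_\<mu>[OF m])
  qed
  \<comment> \<open>Weak convergence on the line does not mention \<open>C\<close>, so concentration
    on \<open>C\<close> is carried to the limit by a test function: the truncated distance to
    \<open>C\<close> has integral zero under every coded measure, hence under
    \<open>\<nu>\<close>.\<close>
  have AEC: "AE t in \<nu>. t \<in> C"
  proof -
    define u where "u t = min 1 (infdist t C)" for t
    have u: "continuous_on UNIV u" "\<And>t. norm (u t) \<le> 1"
      unfolding u_def by (auto intro!: continuous_intros simp: infdist_nonneg)
    then have um: "u \<in> borel_measurable borel" by (intro borel_measurable_continuous_onI)
    have "(\<integral>x. u (h x) \<partial>measure_pmf (P (s n))) = 0" for n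
    proof -
      have "AE x in measure_pmf (P (s n)). u (h x) = 0"
        using AEX by eventually_elim (use h in \<open>auto simp: u_def\<close>)
      then show ?thesis by (rule integral_eq_zero_AE)
    qed
    then have "integral\<^sup>L \<nu> u = 0" using conv_int[OF u] LIMSEQ_unique[OF _ tendsto_const] by simp
    moreover have "integrable \<nu> u"
      using u(2) um by (intro \<nu>.integrable_const_bound[where B = 1]) auto
    ultimately have "AE t in \<nu>. u t = 0"
      by (subst (asm) integral_nonneg_eq_0_iff_AE) (auto simp: u_def infdist_nonneg)
    then show ?thesis
      by eventually_elim
         (use in_closed_iff_infdist_zero[OF compact_imp_closed[OF C] Cne] in \<open>auto simp: u_def min_def split: if_splits\<close>)
  qed
  \<comment> \<open>The default \<open>x0\<close> is used only on a \<open>\<nu>\<close>-null set;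
    it makes the decoding map total with values in \<open>X\<close>.\<close>
  define \<pi>' where "\<pi>' t = (if t \<in> C then \<pi> t else x0)" for t
  have [measurable]: "C \<in> sets borel" using C by (intro borel_closed compact_imp_closed)
  have "\<pi>' \<in> borel_measurable borel"
    unfolding \<pi>'_def
    by (subst measurable_If_restrict_space_iff)
       (auto intro!: borel_measurable_continuous_on_restrict \<pi>(1))
  then have m\<pi>: "\<pi>' \<in> measurable \<nu> (restrict_space borel X)"
    using \<pi>(2) x0 by (intro measurable_restrict_space2) (auto simp: \<pi>'_def image_subset_iff)
  define M where "M = distr \<nu> (restrict_space borel X) \<pi>'"
  show thesis
  proof (rule that[OF s])
    show "prob_space M" unfolding M_def by (rule \<nu>.prob_space_distr[OF m\<pi>])
    show "sets M = sets (restrict_space borel X)" by (simp add: M_def)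
    fix g :: "'a \<Rightarrow> real" assume g: "continuous_on X g"
    have c: "continuous_on C (\<lambda>t. g (\<pi> t))"
      by (rule continuous_on_compose2[OF g \<pi>(1)]) (use \<pi>(2) in auto)
    have "bounded ((\<lambda>t. g (\<pi> t)) ` C)"
      using compact_continuous_image[OF c C] by (rule compact_imp_bounded)
    then obtain B where B: "\<And>t. t \<in> C \<Longrightarrow> norm (g (\<pi> t)) \<le> B" unfolding bounded_iff by auto
    have "B \<ge> 0" using Cne B norm_ge_zero by (metis ex_in_conv order_trans)
    have closedC: "closedin (top_of_set UNIV) C" using compact_imp_closed[OF C] by simp
    \<comment> \<open>The decoded function lives on \<open>C\<close> only, while weak convergence is
      tested by bounded continuous functions on the whole line.\<close>
    obtain G where G: "continuous_on UNIV G" "\<And>t. t \<in> C \<Longrightarrow> G t = g (\<pi> t)" "\<And>t. norm (G t) \<le> B"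
      using Tietze[OF c closedC \<open>B \<ge> 0\<close> B] by (metis UNIV_I)
    have "integral\<^sup>L M g = (\<integral>t. g (\<pi>' t) \<partial>\<nu>)"
      unfolding M_def by (rule integral_distr[OF m\<pi>]) (rule borel_measurable_continuous_on_restrict[OF g])
    also have "\<dots> = integral\<^sup>L \<nu> G"
    proof (rule integral_cong_AE)
      show "(\<lambda>t. g (\<pi>' t)) \<in> borel_measurable \<nu>"
        using measurable_compose[OF m\<pi> borel_measurable_continuous_on_restrict[OF g]] .
      show "G \<in> borel_measurable \<nu>" using borel_measurable_continuous_onI[OF G(1)] by simp
      show "AE t in \<nu>. g (\<pi>' t) = G t" using AEC by eventually_elim (simp add: \<pi>'_def G)
    qed
    finally have lim: "integral\<^sup>L M g = integral\<^sup>L \<nu> G" .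
    have "(\<integral>x. G (h x) \<partial>measure_pmf (P (s n))) = integral\<^sup>L (measure_pmf (P (s n))) g" for n
    proof (rule integral_cong_AE)
      show "AE x in measure_pmf (P (s n)). G (h x) = g x"
        using AEX by eventually_elim (use h G(2) in force)
    qed simp_all
    then show "(\<lambda>n. integral\<^sup>L (measure_pmf (P (s n))) g) \<longlonglongrightarrow> integral\<^sup>L M g"
      using conv_int[OF G(1,3)] lim by simp
  qed
qed

lemma birk_add: "birk T g (m + n) x = birk T g m x + birk T g n ((T ^^ m) x)"
proof (induction n)
  case (Suc n)
  have "(T ^^ (m + n)) x = (T ^^ n) ((T ^^ m) x)" by (metis add.commute comp_apply funpow_add)
  with Suc show ?case by (simp add: birk_def)
qed (simp add: birk_def)

text \<open>The indicator of a closed set is the pointwise limit of truncations of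
  \<open>1 - n * infdist x C\<close>, and closed sets form a generator stable under
  intersection.\<close>

lemma borel_measure_eqI_continuous:
  fixes M N :: "'a::metric_space measure"
  assumes "prob_space M" "prob_space N" and sets: "sets M = sets borel" "sets N = sets borel"
    and eq: "\<And>g :: 'a \<Rightarrow> real. continuous_on UNIV g \<Longrightarrow> (\<And>x. \<bar>g x\<bar> \<le> 1) \<Longrightarrow> integral\<^sup>L M g = integral\<^sup>L N g"
  shows "M = N"
proof -
  interpret M: prob_space M by fact
  interpret N: prob_space N by fact
  have closed_eq: "emeasure M C = emeasure N C" if "closed C" for C
  proof (cases "C = {}")
    case False
    define g where "g n x = max 0 (1 - real n * infdist x C)" for n x
    have g_cont: "continuous_on UNIV (g n)" for n
      unfolding g_def by (intro continuous_intros)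
    have g_le: "\<bar>g n x\<bar> \<le> 1" for n x by (simp add: g_def infdist_nonneg)
    have g_lim: "(\<lambda>n. g n x) \<longlonglongrightarrow> indicator C x" for x
    proof (cases "x \<in> C")
      case False
      then have "infdist x C > 0"
        using \<open>closed C\<close> \<open>C \<noteq> {}\<close> by (metis in_closed_iff_infdist_zero infdist_nonneg order_le_less)
      then obtain k where k: "1 < real k * infdist x C" using reals_Archimedean3 by blast
      have "g n x = 0" if "n \<ge> k" for n
      proof -
        have "real k * infdist x C \<le> real n * infdist x C"
          using that \<open>infdist x C > 0\<close> by (intro mult_right_mono) auto
        then show ?thesis using k by (simp add: g_def)
      qed
      then have "eventually (\<lambda>n. g n x = 0) sequentially" by (auto simp: eventually_sequentially)
      then show ?thesis using False by (simp add: tendsto_eventually)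
    qed (simp add: g_def)
    have conv: "(\<lambda>n. integral\<^sup>L L (g n)) \<longlonglongrightarrow> measure L C" if "prob_space L" "sets L = sets borel" for L
    proof -
      interpret L: prob_space L by fact
      have "(\<lambda>n. integral\<^sup>L L (g n)) \<longlonglongrightarrow> integral\<^sup>L L (indicator C)"
      proof (rule integral_dominated_convergence[where w = "\<lambda>_. 1"])
        show "(indicator C :: 'a \<Rightarrow> real) \<in> borel_measurable L"
          using \<open>closed C\<close> that(2) by (intro borel_measurable_indicator) auto
        show "g n \<in> borel_measurable L" for n
          using borel_measurable_continuous_onI[OF g_cont] measurable_cong_sets[OF that(2) refl] by blast
      qed (use g_lim g_le in auto)
      moreover have "C \<subseteq> space L" using sets_eq_imp_space_eq[OF that(2)] by simp
      ultimately show ?thesis by (simp add: Int_absorb2)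
    qed
    have "measure M C = measure N C"
      using conv[OF M.prob_space_axioms sets(1)] conv[OF N.prob_space_axioms sets(2)] eq[OF g_cont g_le]
      by (simp add: LIMSEQ_unique)
    then show ?thesis by (simp add: M.emeasure_eq_measure N.emeasure_eq_measure)
  qed simp
  have gen: "sets (borel :: 'a measure) = sigma_sets UNIV (Collect closed)"
    by (simp add: borel_eq_closed)
  show ?thesis
    by (rule measure_eqI_generator_eq[of "Collect closed" UNIV _ _ "\<lambda>_. UNIV"])
       (auto simp: Int_stable_def closed_eq sets gen)
qed

section \<open>Asymptotically additive potentials and empirical measures\<close>

locale compact_system =
  fixes X :: "'a::metric_space set" and T :: "'a \<Rightarrow> 'a"
  assumes compact_X: "compact X" and maps: "T ` X \<subseteq> X" and cont: "continuous_on X T"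
begin

lemma funpow_in: "x \<in> X \<Longrightarrow> (T ^^ n) x \<in> X"
  using maps by (induction n) auto

lemma continuous_on_funpow: "continuous_on X (T ^^ n)"
proof (induction n)
  case (Suc n)
  have "continuous_on X (T \<circ> (T ^^ n))"
    by (rule continuous_on_compose[OF Suc continuous_on_subset[OF cont]]) (use funpow_in in auto)
  then show ?case by simp
qed (simp add: id_def)

lemma continuous_on_birk:
  assumes "continuous_on X g"
  shows "continuous_on X (birk T g n)"
proof -
  have "continuous_on X (\<lambda>x. \<Sum>i<n. g ((T ^^ i) x))"
    by (intro continuous_on_sum continuous_on_compose2[OF assms continuous_on_funpow])
       (use funpow_in in auto)
  then show ?thesis by (simp add: birk_def[abs_def])
qed

lemma bounded_cont:
  fixes g :: "'a \<Rightarrow> real"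
  assumes "continuous_on X g"
  obtains B where "B > 0" "\<And>x. x \<in> X \<Longrightarrow> \<bar>g x\<bar> \<le> B"
  using compact_imp_bounded[OF compact_continuous_image[OF assms compact_X]]
  unfolding bounded_pos by auto

section \<open>Uniform approximation of potentials by Birkhoff sums\<close>

text \<open>The family is kept explicit because a generic point controls only countably many functions.\<close>

definition approximable :: "('a \<Rightarrow> real) set \<Rightarrow> (nat \<Rightarrow> 'a \<Rightarrow> real) \<Rightarrow> bool" where
  "approximable \<G> f \<longleftrightarrow> (\<forall>\<xi>>0. \<exists>g\<in>\<G>. continuous_on X g \<and>
     (\<forall>\<^sub>F n in sequentially. \<forall>x\<in>X. \<bar>f n x - birk T g n x\<bar> \<le> \<xi> * real n))"

lemma AAP_approximable:
  assumes "AAP X T f"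
  shows "approximable {g. continuous_on X g} f"
  unfolding approximable_def
proof (intro allI impI)
  fix \<xi> :: real assume "\<xi> > 0"
  then obtain g where g: "continuous_on X g"
    and lim: "limsup (\<lambda>n. ereal (supnorm_on X (\<lambda>x. f n x - birk T g n x) / real n)) < ereal \<xi>"
    using assms unfolding AAP_def by blast
  have "\<forall>\<^sub>F n in sequentially. \<forall>x\<in>X. \<bar>f n x - birk T g n x\<bar> \<le> \<xi> * real n"
    using Limsup_lessD[OF lim] eventually_gt_at_top[of 0]
  proof eventually_elim
    case (elim n)
    \<comment> \<open>A real supremum bounds its members only if the set is bounded above;
      compactness of \<open>X\<close> supplies this for \<open>supnorm_on\<close>.\<close>
    have "continuous_on X (\<lambda>x. f n x - birk T g n x)"
      using assms g by (intro continuous_intros continuous_on_birk) (auto simp: AAP_def)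
    then obtain B where "\<And>x. x \<in> X \<Longrightarrow> \<bar>f n x - birk T g n x\<bar> \<le> B" using bounded_cont by blast
    then have "bdd_above ((\<lambda>x. \<bar>f n x - birk T g n x\<bar>) ` X)" by (rule bdd_aboveI2)
    then have "\<bar>f n x - birk T g n x\<bar> \<le> supnorm_on X (\<lambda>x. f n x - birk T g n x)" if "x \<in> X" for x
      unfolding supnorm_on_def using that by (rule cSUP_upper[rotated])
    moreover have "supnorm_on X (\<lambda>x. f n x - birk T g n x) < \<xi> * real n"
      using elim by (simp add: pos_divide_less_eq)
    ultimately show ?case by force
  qed
  with g show "\<exists>g\<in>{g. continuous_on X g}. continuous_on X g \<and>
     (\<forall>\<^sub>F n in sequentially. \<forall>x\<in>X. \<bar>f n x - birk T g n x\<bar> \<le> \<xi> * real n)" by blast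
qed

lemma AAP_countably_approximable:
  assumes "AAP X T f"
  obtains G :: "nat \<Rightarrow> 'a \<Rightarrow> real" where "\<And>i. continuous_on X (G i)" "approximable (range G) f"
proof -
  define Q where "Q i g \<longleftrightarrow> continuous_on X g \<and>
     (\<forall>\<^sub>F n in sequentially. \<forall>x\<in>X. \<bar>f n x - birk T g n x\<bar> \<le> 1 / real (Suc i) * real n)" for i g
  have "\<exists>g. Q i g" for i
    using AAP_approximable[OF assms, unfolded approximable_def, rule_format, of "1 / real (Suc i)"]
    unfolding Q_def by auto
  then obtain G where G: "\<And>i. Q i (G i)" by metis
  show thesis
  proof (rule that)
    show "continuous_on X (G i)" for i using G[of i] by (simp add: Q_def)
    show "approximable (range G) f" unfolding approximable_def
    proof (intro allI impI)
      fix \<xi> :: real assume "\<xi> > 0"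
      then obtain i where i: "1 / real (Suc i) < \<xi>" using nat_approx_posE by blast
      have "\<forall>\<^sub>F n in sequentially. \<forall>x\<in>X. \<bar>f n x - birk T (G i) n x\<bar> \<le> \<xi> * real n"
        using conjunct2[OF G[of i, unfolded Q_def]]
      proof eventually_elim
        case (elim n)
        have "1 / real (Suc i) * real n \<le> \<xi> * real n" using i by (intro mult_right_mono) auto
        with elim show ?case by force
      qed
      then show "\<exists>g\<in>range G. continuous_on X g \<and>
         (\<forall>\<^sub>F n in sequentially. \<forall>x\<in>X. \<bar>f n x - birk T g n x\<bar> \<le> \<xi> * real n)"
        using G[of i] unfolding Q_def by blast
    qed
  qed
qed

lemma integrable_cont:
  fixes g :: "'a \<Rightarrow> real"
  assumes "prob_space M" "sets M = sets (restrict_space borel X)" "continuous_on X g"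
  shows "integrable M g"
proof -
  interpret prob_space M by fact
  obtain B where B: "\<And>x. x \<in> X \<Longrightarrow> \<bar>g x\<bar> \<le> B" using bounded_cont[OF assms(3)] by blast
  have sp: "space M = X" using sets_eq_imp_space_eq[OF assms(2)] by (simp add: space_restrict_space)
  show ?thesis
  proof (rule integrable_const_bound[where B = B])
    show "AE x in M. norm (g x) \<le> B" using B sp by (intro AE_I2) auto
    show "g \<in> borel_measurable M"
      using borel_measurable_continuous_on_restrict[OF assms(3)] measurable_cong_sets[OF assms(2) refl]
      by blast
  qed
qed

lemma inv_measuresD:
  assumes "M \<in> inv_measures X T"
  shows "prob_space M" "sets M = sets (restrict_space borel X)" "space M = X"
    "T \<in> measurable M M" "distr M M T = M"
  using assms sets_eq_imp_space_eq[of M "restrict_space borel X"]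
  by (auto simp: inv_measures_def space_restrict_space)

lemma integral_funpow:
  fixes g :: "'a \<Rightarrow> real"
  assumes M: "M \<in> inv_measures X T" and g: "continuous_on X g"
  shows "(\<integral>x. g ((T ^^ n) x) \<partial>M) = integral\<^sup>L M g"
proof (induction n)
  case (Suc n)
  have c: "continuous_on X (\<lambda>x. g ((T ^^ n) x))"
    by (rule continuous_on_compose2[OF g continuous_on_funpow]) (use funpow_in in auto)
  have "(\<integral>x. g ((T ^^ Suc n) x) \<partial>M) = (\<integral>x. g ((T ^^ n) (T x)) \<partial>M)" by (simp add: funpow_swap1)
  also have "\<dots> = (\<integral>x. g ((T ^^ n) x) \<partial>distr M M T)"
    by (rule integral_distr[symmetric, OF inv_measuresD(4)[OF M]])
       (use integrable_cont[OF inv_measuresD(1,2)[OF M] c] in auto)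
  finally show ?case using Suc inv_measuresD(5)[OF M] by simp
qed simp

lemma integral_birk:
  assumes M: "M \<in> inv_measures X T" and g: "continuous_on X g"
  shows "integral\<^sup>L M (birk T g n) = real n * integral\<^sup>L M g"
proof -
  have "integrable M (\<lambda>x. g ((T ^^ i) x))" for i
    by (intro integrable_cont[OF inv_measuresD(1,2)[OF M]] continuous_on_compose2[OF g continuous_on_funpow])
       (use funpow_in in auto)
  then show ?thesis
    unfolding birk_def[abs_def] by (simp add: integral_funpow[OF M g])
qed

text \<open>By invariance the Birkhoff sum of \<open>g\<close> integrates to exactly
  \<open>n\<close> times the integral of \<open>g\<close>, so the uniform error
  \<open>\<xi> * n\<close> passes unchanged to the normalised integrals.\<close>

lemma integral_AAP_close:
  assumes M: "M \<in> inv_measures X T" and f: "AAP X T f" and g: "continuous_on X g"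
    and ev: "\<forall>\<^sub>F n in sequentially. \<forall>x\<in>X. \<bar>f n x - birk T g n x\<bar> \<le> \<xi> * real n"
  shows "\<forall>\<^sub>F n in sequentially. \<bar>integral\<^sup>L M (f n) / real n - integral\<^sup>L M g\<bar> \<le> \<xi>"
  using ev eventually_gt_at_top[of 0]
proof eventually_elim
  case (elim n)
  interpret prob_space M using inv_measuresD[OF M] by blast
  have i1: "integrable M (f n)"
    using f by (intro integrable_cont[OF inv_measuresD(1,2)[OF M]]) (simp add: AAP_def)
  have i2: "integrable M (birk T g n)"
    by (intro integrable_cont[OF inv_measuresD(1,2)[OF M]] continuous_on_birk g)
  have "\<bar>\<integral>x. f n x - birk T g n x \<partial>M\<bar> \<le> (\<integral>x. \<bar>f n x - birk T g n x\<bar> \<partial>M)"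
    by (rule integral_abs_bound)
  also have "\<dots> \<le> \<xi> * real n"
    by (rule integral_le_const) (use i1 i2 elim inv_measuresD(3)[OF M] in auto)
  also have "(\<integral>x. f n x - birk T g n x \<partial>M) = integral\<^sup>L M (f n) - real n * integral\<^sup>L M g"
    using integral_birk[OF M g] i1 i2 by simp
  finally have "\<bar>integral\<^sup>L M (f n) - real n * integral\<^sup>L M g\<bar> \<le> \<xi> * real n" .
  moreover have "integral\<^sup>L M (f n) / real n - integral\<^sup>L M g
      = (integral\<^sup>L M (f n) - real n * integral\<^sup>L M g) / real n" using elim by (simp add: field_simps)
  ultimately show ?case using elim by (simp add: abs_divide pos_divide_le_eq)
qed

text \<open>\<open>Fstar\<close> is written with \<open>lim\<close>, which carries information only
  once convergence is known. Each approximant confines a tail to an interval of length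
  \<open>2 * e / 3\<close>, whence the sequence is Cauchy.\<close>

lemma Fstar_LIMSEQ:
  assumes M: "M \<in> inv_measures X T" and f: "AAP X T f"
  shows "(\<lambda>n. integral\<^sup>L M (f n) / real n) \<longlonglongrightarrow> Fstar f M"
proof -
  have "Cauchy (\<lambda>n. integral\<^sup>L M (f n) / real n)"
  proof (rule metric_CauchyI)
    fix e :: real assume "e > 0"
    then obtain g where g: "continuous_on X g"
      "\<forall>\<^sub>F n in sequentially. \<forall>x\<in>X. \<bar>f n x - birk T g n x\<bar> \<le> e / 3 * real n"
      using AAP_approximable[OF f, unfolded approximable_def, rule_format, of "e/3"] by auto
    from integral_AAP_close[OF M f g] obtain N where
      N: "\<And>n. n \<ge> N \<Longrightarrow> \<bar>integral\<^sup>L M (f n) / real n - integral\<^sup>L M g\<bar> \<le> e / 3"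
      by (auto simp: eventually_sequentially)
    show "\<exists>N. \<forall>m\<ge>N. \<forall>n\<ge>N. dist (integral\<^sup>L M (f m) / real m) (integral\<^sup>L M (f n) / real n) < e"
    proof (intro exI allI impI)
      fix m n assume "m \<ge> N" "n \<ge> N"
      with N[of m] N[of n] \<open>e > 0\<close>
      show "dist (integral\<^sup>L M (f m) / real m) (integral\<^sup>L M (f n) / real n) < e"
        unfolding dist_real_def by linarith
    qed
  qed
  then show ?thesis
    unfolding Fstar_def by (simp add: Cauchy_convergent_iff convergent_LIMSEQ_iff)
qed

text \<open>Convergence is assumed for \<open>\<G>\<close> alone and along any \<open>r\<close>
  tending to infinity. This serves both uses: all continuous functions along a subsequence, for
  empirical limits, and a countable family along all times, for generic points.\<close>

lemma orbit_average_LIMSEQ: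
  assumes M: "M \<in> inv_measures X T" and f: "AAP X T f" and \<G>: "approximable \<G> f"
    and x: "x \<in> X" and r: "filterlim r at_top sequentially"
    and lim: "\<And>g. g \<in> \<G> \<Longrightarrow> (\<lambda>k. birk T g (r k) x / real (r k)) \<longlonglongrightarrow> integral\<^sup>L M g"
  shows "(\<lambda>k. f (r k) x / real (r k)) \<longlonglongrightarrow> Fstar f M"
proof (rule tendstoI)
  fix e :: real assume "e > 0"
  then have "e / 3 > 0" by simp
  from \<G>[unfolded approximable_def, rule_format, OF this] obtain g where g: "g \<in> \<G>" "continuous_on X g"
    and ev: "\<forall>\<^sub>F n in sequentially. \<forall>x\<in>X. \<bar>f n x - birk T g n x\<bar> \<le> e / 3 * real n"
    by blast
  have close: "\<bar>Fstar f M - integral\<^sup>L M g\<bar> \<le> e / 3"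
    by (rule tendsto_upperbound[OF tendsto_rabs[OF tendsto_diff[OF Fstar_LIMSEQ[OF M f] tendsto_const]]])
       (use integral_AAP_close[OF M f g(2) ev] in auto)
  have "\<forall>\<^sub>F k in sequentially. \<forall>x\<in>X. \<bar>f (r k) x - birk T g (r k) x\<bar> \<le> e / 3 * real (r k)"
    using eventually_compose_filterlim[OF ev r] .
  moreover have "\<forall>\<^sub>F k in sequentially. r k > 0"
    using eventually_compose_filterlim[OF eventually_gt_at_top r] .
  moreover have "\<forall>\<^sub>F k in sequentially. dist (birk T g (r k) x / real (r k)) (integral\<^sup>L M g) < e / 3"
    using lim[OF g(1)] \<open>e > 0\<close> by (intro tendstoD) auto
  ultimately show "\<forall>\<^sub>F k in sequentially. dist (f (r k) x / real (r k)) (Fstar f M) < e"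
  proof eventually_elim
    case (elim k)
    have "\<bar>f (r k) x / real (r k) - birk T g (r k) x / real (r k)\<bar>
        = \<bar>f (r k) x - birk T g (r k) x\<bar> / real (r k)"
      by (simp add: diff_divide_distrib[symmetric] abs_divide)
    also have "\<dots> \<le> e / 3" using elim x by (simp add: pos_divide_le_eq)
    finally show ?case using elim close unfolding dist_real_def by linarith
  qed
qed

section \<open>Invariance of empirical limits and subsequential realisation\<close>

lemma inv_measureI_continuous:
  assumes M: "prob_space M" "sets M = sets (restrict_space borel X)"
    and inv: "\<And>g :: 'a \<Rightarrow> real. continuous_on X g \<Longrightarrow> (\<integral>x. g (T x) \<partial>M) = integral\<^sup>L M g"
  shows "M \<in> inv_measures X T"
proof -
  interpret prob_space M by fact
  have sp: "space M = X" using sets_eq_imp_space_eq[OF M(2)] by (simp add: space_restrict_space)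
  have T: "T \<in> measurable M M"
  proof -
    have "T \<in> measurable (restrict_space borel X) (restrict_space borel X)"
      using maps by (intro measurable_restrict_space2 borel_measurable_continuous_on_restrict[OF cont])
        (auto simp: space_restrict_space)
    then show ?thesis using measurable_cong_sets[OF M(2) M(2)] by blast
  qed
  have idm: "(\<lambda>x. x) \<in> measurable L borel" if "sets L = sets (restrict_space borel X)" for L
    using borel_measurable_continuous_on_restrict[OF continuous_on_id[of X]]
      measurable_cong_sets[OF that refl] by blast
  let ?N = "distr M M T"
  interpret N: prob_space ?N by (rule prob_space_distr[OF T])
  have Ns: "sets ?N = sets (restrict_space borel X)" using M(2) by simp
  \<comment> \<open>Both measures live on the restricted sigma-algebra of \<open>X\<close>; pushing
    them along the inclusion brings them to \<open>borel\<close>, where continuous functions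
    determine a measure.\<close>
  have eq: "distr M borel (\<lambda>x. x) = distr ?N borel (\<lambda>x. x)"
  proof (rule borel_measure_eqI_continuous)
    show "prob_space (distr M borel (\<lambda>x. x))" using idm[OF M(2)] by (rule prob_space_distr)
    show "prob_space (distr ?N borel (\<lambda>x. x))" using idm[OF Ns] by (rule N.prob_space_distr)
    fix g :: "'a \<Rightarrow> real" assume g: "continuous_on UNIV g"
    have gm: "g \<in> borel_measurable borel" by (rule borel_measurable_continuous_onI[OF g])
    have "integral\<^sup>L (distr ?N borel (\<lambda>x. x)) g = integral\<^sup>L ?N g"
      by (rule integral_distr[OF idm[OF Ns] gm])
    also have "\<dots> = (\<integral>x. g (T x) \<partial>M)"
      by (rule integral_distr[OF T]) (rule measurable_compose[OF idm[OF M(2)] gm])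
    also have "\<dots> = integral\<^sup>L M g" by (intro inv continuous_on_subset[OF g]) simp
    also have "\<dots> = integral\<^sup>L (distr M borel (\<lambda>x. x)) g"
      by (rule integral_distr[OF idm[OF M(2)] gm, symmetric])
    finally show "integral\<^sup>L (distr M borel (\<lambda>x. x)) g = integral\<^sup>L (distr ?N borel (\<lambda>x. x)) g" by simp
  qed simp_all
  have "?N = M"
  proof (rule measure_eqI)
    fix A assume "A \<in> sets ?N"
    then obtain B where B: "B \<in> sets borel" "A = B \<inter> X"
      unfolding Ns sets_restrict_space by auto
    have "emeasure ?N A = emeasure (distr ?N borel (\<lambda>x. x)) B"
      using B idm[OF Ns] sp by (subst emeasure_distr) auto
    also have "\<dots> = emeasure (distr M borel (\<lambda>x. x)) B" using eq by simp
    also have "\<dots> = emeasure M A"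
      using B idm[OF M(2)] sp by (subst emeasure_distr) auto
    finally show "emeasure ?N A = emeasure M A" .
  qed simp
  then show ?thesis using M T by (simp add: inv_measures_def)
qed

text \<open>Replacing \<open>g\<close> by \<open>g\<close> after \<open>T\<close> changes a Birkhoff
  sum only by the boundary term \<open>g ((T ^^ n) x) - g x\<close>, which is bounded and disappears
  after division by the length.\<close>

lemma emp_limits_invariant:
  assumes x: "x \<in> X" and M: "M \<in> emp_limits X T x"
  shows "M \<in> inv_measures X T"
proof -
  from M obtain r where P: "prob_space M" "sets M = sets (restrict_space borel X)"
    and r: "strict_mono r"
    and lim: "\<And>g. continuous_on X g \<Longrightarrow> (\<lambda>k. birk T g (r k) x / real (r k)) \<longlonglongrightarrow> integral\<^sup>L M g"
    unfolding emp_limits_def by blast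
  show ?thesis
  proof (rule inv_measureI_continuous[OF P])
    fix g :: "'a \<Rightarrow> real" assume g: "continuous_on X g"
    obtain B where B: "\<And>x. x \<in> X \<Longrightarrow> \<bar>g x\<bar> \<le> B" using bounded_cont[OF g] by blast
    have gT: "continuous_on X (\<lambda>x. g (T x))"
      by (rule continuous_on_compose2[OF g cont]) (use maps in auto)
    have shift: "birk T (\<lambda>x. g (T x)) n x = birk T g n x + (g ((T ^^ n) x) - g x)" for n
    proof -
      have "birk T g (Suc n) x = g x + birk T (\<lambda>x. g (T x)) n x"
        unfolding birk_def by (subst sum.lessThan_Suc_shift) (simp add: funpow_swap1)
      then show ?thesis by (simp add: birk_def)
    qed
    have "(\<lambda>k. (g ((T ^^ r k) x) - g x) / real (r k)) \<longlonglongrightarrow> 0"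
    proof (rule tendsto_0_le[where K = "2 * B"])
      show "(\<lambda>k. 1 / real (r k)) \<longlonglongrightarrow> 0"
        using filterlim_compose[OF lim_1_over_n filterlim_subseq[OF r]] by simp
      show "\<forall>\<^sub>F k in sequentially. norm ((g ((T ^^ r k) x) - g x) / real (r k)) \<le> norm (1 / real (r k)) * (2 * B)"
      proof (intro always_eventually allI)
        fix k
        have "\<bar>g ((T ^^ r k) x) - g x\<bar> \<le> 2 * B" using B[OF x] B[OF funpow_in[OF x, of "r k"]] by linarith
        then show "norm ((g ((T ^^ r k) x) - g x) / real (r k)) \<le> norm (1 / real (r k)) * (2 * B)"
          by (auto simp: abs_divide intro: divide_right_mono)
      qed
    qed
    from tendsto_add[OF lim[OF g] this]
    have "(\<lambda>k. birk T (\<lambda>x. g (T x)) (r k) x / real (r k)) \<longlonglongrightarrow> integral\<^sup>L M g"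
      by (simp add: shift add_divide_distrib)
    with lim[OF gT] show "(\<integral>x. g (T x) \<partial>M) = integral\<^sup>L M g" by (rule LIMSEQ_unique)
  qed
qed

lemma emp_limit_AAP:
  assumes x: "x \<in> X" and M: "M \<in> emp_limits X T x"
  obtains r where "strict_mono r"
    "\<And>f. AAP X T f \<Longrightarrow> (\<lambda>k. f (r k) x / real (r k)) \<longlonglongrightarrow> Fstar f M"
proof -
  from M obtain r where r: "strict_mono r"
    and lim: "\<And>g. continuous_on X g \<Longrightarrow> (\<lambda>k. birk T g (r k) x / real (r k)) \<longlonglongrightarrow> integral\<^sup>L M g"
    unfolding emp_limits_def by blast
  show thesis
    by (rule that[OF r], rule orbit_average_LIMSEQ[OF emp_limits_invariant[OF x M] _ AAP_approximable])
       (use x lim filterlim_subseq[OF r] in auto)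
qed

text \<open>Weak* compactness is applied to the uniform measures on orbit segments of lengths taken
  from \<open>r\<close>. Prescribing \<open>r\<close> makes it possible to find a limit measure
  along times that realise a limsup.\<close>

lemma emp_limit_along_subsequence:
  assumes x: "x \<in> X" and r: "strict_mono (r :: nat \<Rightarrow> nat)"
  obtains s M where "strict_mono s" "M \<in> emp_limits X T x"
    "\<And>f. AAP X T f \<Longrightarrow> (\<lambda>k. f (r (s k)) x / real (r (s k))) \<longlonglongrightarrow> Fstar f M"
proof -
  have pos: "r (Suc n) > 0" for n using strict_monoD[OF r, of 0 "Suc n"] by simp
  \<comment> \<open>The index is shifted because \<open>r 0\<close> may be 0, and
    \<open>pmf_of_set\<close> needs a nonempty set.\<close>
  define P where "P n = map_pmf (\<lambda>i. (T ^^ i) x) (pmf_of_set {..<r (Suc n)})" for n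
  have ne: "{..<r (Suc n)} \<noteq> {}" for n using pos[of n] by auto
  have PX: "set_pmf (P n) \<subseteq> X" for n
    using funpow_in[OF x] ne[of n] by (auto simp: P_def)
  obtain s M where s: "strict_mono s"
    and M: "prob_space M" "sets M = sets (restrict_space borel X)"
    and lim: "\<And>g :: 'a \<Rightarrow> real. continuous_on X g \<Longrightarrow>
        (\<lambda>n. integral\<^sup>L (measure_pmf (P (s n))) g) \<longlonglongrightarrow> integral\<^sup>L M g"
    by (rule compact_weak_limit[OF compact_X, of P, OF PX], rule that)
  have avg: "integral\<^sup>L (measure_pmf (P n)) g = birk T g (r (Suc n)) x / real (r (Suc n))" for n g
    using ne[of n] by (simp add: P_def integral_pmf_of_set birk_def)
  define s' where "s' k = Suc (s k)" for k
  have s': "strict_mono s'" using s by (simp add: s'_def strict_mono_def)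
  have lim': "(\<lambda>k. birk T g (r (s' k)) x / real (r (s' k))) \<longlonglongrightarrow> integral\<^sup>L M g"
    if "continuous_on X g" for g using lim[OF that] by (simp add: avg s'_def)
  have rs: "strict_mono (\<lambda>k. r (s' k))" using strict_mono_o[OF r s'] by (simp add: o_def)
  have Mlim: "M \<in> emp_limits X T x"
    unfolding emp_limits_def using M rs lim' by blast
  show thesis
  proof (rule that[OF s' Mlim])
    fix f assume "AAP X T f"
    then show "(\<lambda>k. f (r (s' k)) x / real (r (s' k))) \<longlonglongrightarrow> Fstar f M"
      by (rule orbit_average_LIMSEQ[OF emp_limits_invariant[OF x Mlim] _ AAP_approximable])
         (use \<open>AAP X T f\<close> x lim' filterlim_subseq[OF rs] in auto)
  qed
qed

lemma limsup_eq_Fstar: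
  assumes x: "x \<in> X" and f: "AAP X T f"
  obtains M where "M \<in> emp_limits X T x" "limsup (\<lambda>n. ereal (f n x / real n)) = ereal (Fstar f M)"
proof -
  obtain r :: "nat \<Rightarrow> nat" where r: "strict_mono r"
    "((\<lambda>n. ereal (f n x / real n)) \<circ> r) \<longlonglongrightarrow> limsup (\<lambda>n. ereal (f n x / real n))"
    using limsup_subseq_lim by blast
  obtain s M where s: "strict_mono s" and M: "M \<in> emp_limits X T x"
    and lim: "\<And>f. AAP X T f \<Longrightarrow> (\<lambda>k. f (r (s k)) x / real (r (s k))) \<longlonglongrightarrow> Fstar f M"
    using emp_limit_along_subsequence[OF x r(1)] by blast
  have "(\<lambda>k. ereal (f (r (s k)) x / real (r (s k)))) \<longlonglongrightarrow> ereal (Fstar f M)"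
    using lim[OF f] by (rule tendsto_ereal)
  moreover have "(\<lambda>k. ereal (f (r (s k)) x / real (r (s k)))) \<longlonglongrightarrow> limsup (\<lambda>n. ereal (f n x / real n))"
    using LIMSEQ_subseq_LIMSEQ[OF r(2) s] by (simp add: o_def)
  ultimately show thesis using that[OF M] LIMSEQ_unique by blast
qed

lemma emp_limits_level_set:
  assumes x: "x \<in> level_set X \<phi> \<alpha>" and M: "M \<in> emp_limits X T x" and \<phi>: "AAP X T \<phi>"
  shows "Fstar \<phi> M = \<alpha>"
proof -
  have "x \<in> X" using x by (simp add: level_set_def)
  then obtain r where r: "strict_mono r" "(\<lambda>k. \<phi> (r k) x / real (r k)) \<longlonglongrightarrow> Fstar \<phi> M"
    using emp_limit_AAP[OF _ M] \<phi> by metis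
  moreover have "(\<lambda>k. \<phi> (r k) x / real (r k)) \<longlonglongrightarrow> \<alpha>"
    using x LIMSEQ_subseq_LIMSEQ[OF _ r(1)] by (force simp: level_set_def o_def)
  ultimately show ?thesis using LIMSEQ_unique by blast
qed

end

section \<open>Generic points from specification\<close>

text \<open>The next point is chosen with nonpositive inner product with the vector of partial sums, so
  that the squared norm of that vector grows at most linearly.\<close>

lemma (in prob_space) greedy_points:
  fixes F :: "nat \<Rightarrow> 'a \<Rightarrow> real"
  assumes int: "\<And>j. j < k \<Longrightarrow> integrable M (F j)" and zero: "\<And>j. j < k \<Longrightarrow> expectation (F j) = 0"
    and bound: "\<And>j x. j < k \<Longrightarrow> x \<in> space M \<Longrightarrow> \<bar>F j x\<bar> \<le> C"
  obtains z :: "nat \<Rightarrow> 'a" where "\<And>i. z i \<in> space M"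
    "\<And>q j. j < k \<Longrightarrow> (\<Sum>i<q. F j (z i))\<^sup>2 \<le> real q * (real k * C\<^sup>2)"
proof -
  \<comment> \<open>The linear form in the \<open>F j\<close> has mean zero, so it cannot be
    positive at every point.\<close>
  have "\<exists>z\<in>space M. (\<Sum>j<k. s j * F j z) \<le> 0" for s :: "nat \<Rightarrow> real"
  proof (rule ccontr)
    assume "\<not> ?thesis"
    then have "0 < expectation (\<lambda>z. \<Sum>j<k. s j * F j z)"
      using int by (intro expectation_greater AE_I2) (auto simp: not_le)
    then show False using int zero by simp
  qed
  then obtain pick where pick: "\<And>s. pick s \<in> space M" "\<And>s. (\<Sum>j<k. s j * F j (pick s)) \<le> 0"
    by metis
  define S where "S = rec_nat (\<lambda>_. 0) (\<lambda>_ s j. s j + F j (pick s))"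
  define z where "z q = pick (S q)" for q
  have S_Suc: "S (Suc q) j = S q j + F j (z q)" for q j by (simp add: S_def z_def)
  have S_sum: "S q j = (\<Sum>i<q. F j (z i))" for q j
    by (induction q) (simp_all add: S_Suc, simp add: S_def)
  have energy: "(\<Sum>j<k. (S q j)\<^sup>2) \<le> real q * (real k * C\<^sup>2)" for q
  proof (induction q)
    case (Suc q)
    have "(S (Suc q) j)\<^sup>2 \<le> (S q j)\<^sup>2 + 2 * (S q j * F j (z q)) + C\<^sup>2" if "j < k" for j
    proof -
      have "(F j (z q))\<^sup>2 \<le> C\<^sup>2"
        using bound[OF that pick(1), of "S q"] unfolding z_def by (subst abs_le_square_iff[symmetric]) linarith
      then show ?thesis by (simp add: S_Suc power2_sum)
    qed
    then have "(\<Sum>j<k. (S (Suc q) j)\<^sup>2) \<le> (\<Sum>j<k. (S q j)\<^sup>2 + 2 * (S q j * F j (z q)) + C\<^sup>2)"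
      by (intro sum_mono) simp
    also have "\<dots> = (\<Sum>j<k. (S q j)\<^sup>2) + 2 * (\<Sum>j<k. S q j * F j (z q)) + real k * C\<^sup>2"
      by (simp add: sum.distrib sum_distrib_left)
    also have "\<dots> \<le> real q * (real k * C\<^sup>2) + real k * C\<^sup>2"
      using Suc pick(2)[of "S q"] by (simp add: z_def)
    finally show ?case by (simp add: algebra_simps)
  qed (simp add: S_def)
  show thesis
  proof (rule that)
    show "z i \<in> space M" for i by (simp add: z_def pick)
    fix q j :: nat assume "j < k"
    then have "(S q j)\<^sup>2 \<le> (\<Sum>j<k. (S q j)\<^sup>2)" by (intro member_le_sum) auto
    then show "(\<Sum>i<q. F j (z i))\<^sup>2 \<le> real q * (real k * C\<^sup>2)"
      using energy[of q] by (simp add: S_sum)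
  qed
qed

section \<open>One stage of the gluing\<close>

text \<open>Turns square-root growth into an arbitrarily small slope plus a constant that does not
  depend on \<open>q\<close>: the cross term of the squared right-hand side is already
  \<open>2 * q * A\<close>.\<close>

lemma abs_le_of_square_le:
  fixes s \<delta> q A :: real
  assumes "s\<^sup>2 \<le> q * A" "\<delta> > 0" "q \<ge> 0" "A \<ge> 0"
  shows "\<bar>s\<bar> \<le> \<delta> * q + A / \<delta>"
proof (rule abs_le_square_iff[THEN iffD2, THEN order_trans])
  show "s\<^sup>2 \<le> (\<delta> * q + A / \<delta>)\<^sup>2"
  proof -
    have "(\<delta> * q + A / \<delta>)\<^sup>2 = (\<delta> * q)\<^sup>2 + (A / \<delta>)\<^sup>2 + 2 * (q * A)"
      using assms by (simp add: power2_sum)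
    then show ?thesis using assms by (smt (verit) mult_nonneg_nonneg zero_le_power2)
  qed
qed (use assms in simp)

lemma birk_le:
  assumes "\<And>i. i < n \<Longrightarrow> \<bar>g ((T ^^ i) x)\<bar> \<le> C"
  shows "\<bar>birk T g n x\<bar> \<le> C * real n"
proof -
  have "norm (\<Sum>i<n. g ((T ^^ i) x)) \<le> real (card {..<n}) * C"
    by (rule sum_norm_bound) (use assms in auto)
  then show ?thesis by (simp add: birk_def mult.commute)
qed

lemma birk_diff_le:
  assumes "\<And>i. i < n \<Longrightarrow> \<bar>g ((T ^^ i) x) - g ((T ^^ i) y)\<bar> \<le> e"
  shows "\<bar>birk T g n x - birk T g n y\<bar> \<le> e * real n"
proof -
  have "norm (\<Sum>i<n. g ((T ^^ i) x) - g ((T ^^ i) y)) \<le> real (card {..<n}) * e"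
    by (rule sum_norm_bound) (use assms in auto)
  then show ?thesis by (simp add: birk_def sum_subtractf mult.commute)
qed

context compact_system
begin

lemma cont_modulus:
  fixes g :: "'a \<Rightarrow> real"
  assumes "continuous_on X g" "e > 0"
  obtains d where "d > 0" "\<And>u v. u \<in> X \<Longrightarrow> v \<in> X \<Longrightarrow> dist u v < d \<Longrightarrow> \<bar>g u - g v\<bar> < e"
proof -
  have "uniformly_continuous_on X g"
    using compact_uniformly_continuous[OF assms(1) compact_X] .
  then obtain d where "d > 0" "\<forall>x\<in>X. \<forall>x'\<in>X. dist x' x < d \<longrightarrow> dist (g x') (g x) < e"
    using assms(2) unfolding uniformly_continuous_on_def by blast
  then show thesis using that[of d] by (auto simp: dist_real_def)
qed

text \<open>\<open>L\<close> depends neither on the orbit segment being extended nor on the lengths \<open>N\<close>, \<open>R\<close>; this is what lets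
  the stage lengths in \<open>generic_point\<close> be fixed in advance.\<close>

lemma specification_step:
  fixes h :: "nat \<Rightarrow> 'a \<Rightarrow> real"
  assumes spec: "has_specification X T" and M: "M \<in> inv_measures X T"
    and h: "\<And>j. continuous_on X (h j)" and zero: "\<And>j. integral\<^sup>L M (h j) = 0" and \<delta>: "\<delta> > 0"
  obtains L :: nat where
    "\<And>x N R. x \<in> X \<Longrightarrow> \<exists>y\<in>X. (\<forall>p\<le>N. dist ((T ^^ p) y) ((T ^^ p) x) < \<delta>) \<and>
       (\<forall>j<k. \<forall>n\<le>R. \<bar>birk T (h j) n ((T ^^ N) y)\<bar> \<le> \<delta> * real n + real L)"
proof -
  interpret prob_space M using inv_measuresD[OF M] by blast
  have "\<exists>B>0. \<forall>x\<in>X. \<bar>h j x\<bar> \<le> B" for j using bounded_cont[OF h] by metis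
  then obtain B where B: "\<And>j. B j > 0" "\<And>j x. x \<in> X \<Longrightarrow> \<bar>h j x\<bar> \<le> B j" by metis
  define C where "C = (\<Sum>j<k. B j)"
  have C0: "C \<ge> 0" unfolding C_def using B(1) by (intro sum_nonneg) (auto intro: less_imp_le)
  have C: "\<bar>h j x\<bar> \<le> C" if "j < k" "x \<in> X" for j x
    using B(2)[OF that(2), of j] member_le_sum[of j "{..<k}" B] that B(1)
    unfolding C_def by (force intro: less_imp_le)
  have "\<exists>d>0. \<forall>u\<in>X. \<forall>v\<in>X. dist u v < d \<longrightarrow> \<bar>h j u - h j v\<bar> < \<delta> / 4" for j
    using cont_modulus[OF h, of "\<delta> / 4"] \<delta> by (metis divide_pos_pos zero_less_numeral)
  then obtain d where d: "\<And>j. d j > 0"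
    "\<And>j u v. u \<in> X \<Longrightarrow> v \<in> X \<Longrightarrow> dist u v < d j \<Longrightarrow> \<bar>h j u - h j v\<bar> < \<delta> / 4" by metis
  define \<eta> where "\<eta> = Min (insert \<delta> (d ` {..<k}))"
  have \<eta>0: "\<eta> > 0" unfolding \<eta>_def using d(1) \<delta> by (subst Min_gr_iff) auto
  have \<eta>\<delta>: "\<eta> \<le> \<delta>" and \<eta>d: "\<And>j. j < k \<Longrightarrow> \<eta> \<le> d j" unfolding \<eta>_def by (auto intro: Min_le)
  obtain m :: nat where m: "\<forall>K a b xs.
        (\<forall>j<K. a j \<le> b j) \<and> (\<forall>j. Suc j < K \<longrightarrow> int (a (Suc j)) - int (b j) \<ge> int m) \<and> (\<forall>j<K. xs j \<in> X) \<longrightarrow>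
        (\<exists>x\<in>X. \<forall>j<K. \<forall>p\<le>b j - a j. dist ((T ^^ (p + a j)) x) ((T ^^ p) (xs j)) < \<eta>)"
    by (rule exE[OF mp[OF HOL.spec[OF spec[unfolded has_specification_def]] \<eta>0]])
  \<comment> \<open>Blocks are made so long that the uncontrolled gap of \<open>m\<close> steps
    after each costs at most \<open>\<delta> / 4\<close> per block step. An interval with endpoints
    \<open>n1\<close> apart contains \<open>n0 = Suc n1\<close> times, hence the two
    constants.\<close>
  obtain n1 :: nat where n1: "C * real m / (\<delta> / 4) < real n1" by (rule exE[OF reals_Archimedean2])
  define n0 where "n0 = Suc n1"
  have "C * real m < real n1 * (\<delta> / 4)" using n1 \<delta> by (simp add: pos_divide_less_eq)
  also have "\<dots> \<le> \<delta> / 4 * real n0" using \<delta> by (simp add: n0_def)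
  finally have gap: "C * real m \<le> \<delta> / 4 * real n0" by simp
  have birk_C: "\<bar>birk T (h j) n x\<bar> \<le> C * real n" if "j < k" "x \<in> X" for j n x
    by (rule birk_le) (use C that funpow_in in auto)
  have sp: "space M = X" using inv_measuresD(3)[OF M] .
  \<comment> \<open>The greedy choice is made for whole block sums, which have mean zero because
    \<open>M\<close> is invariant and each \<open>h j\<close> is centred.\<close>
  obtain z where z: "\<And>i. z i \<in> X" and zsum: "\<And>q j. j < k \<Longrightarrow>
      (\<Sum>i<q. birk T (h j) n0 (z i))\<^sup>2 \<le> real q * (real k * (C * real n0)\<^sup>2)"
  proof (rule greedy_points[of k "\<lambda>j. birk T (h j) n0" "C * real n0"])
    show "integrable M (birk T (h j) n0)" for j
      by (intro integrable_cont[OF inv_measuresD(1,2)[OF M]] continuous_on_birk h)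
    show "expectation (birk T (h j) n0) = 0" for j by (simp add: integral_birk[OF M h] zero)
  qed (use birk_C sp in auto)
  define A where "A = real k * (C * real n0)\<^sup>2"
  define P where "P = n0 + m"
  \<comment> \<open>The three terms pay for the gap before the first block, for the constant part of
    the greedy bound, and for an incomplete last period.\<close>
  define L where "L = nat \<lceil>C * real m + A / (\<delta> / 4) + C * real P\<rceil>"
  have L: "C * real m + A / (\<delta> / 4) + C * real P \<le> real L"
    unfolding L_def by linarith
  have A0: "A \<ge> 0" by (simp add: A_def)
  show thesis
  proof (rule that[of L])
    fix x N R assume x: "x \<in> X"
    \<comment> \<open>Interval 0 follows \<open>x\<close> up to time \<open>N\<close>; interval
      \<open>Suc i\<close> follows \<open>z i\<close> for \<open>n0\<close> times, one per period
      \<open>P\<close>. The first gap is \<open>m\<close>, later ones \<open>m + 1\<close>. As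
      \<open>P \<ge> 1\<close>, \<open>R\<close> blocks cover all times up to
      \<open>R\<close>.\<close>
    define a where "a i = (case i of 0 \<Rightarrow> 0 | Suc i \<Rightarrow> N + m + i * P)" for i
    define b where "b i = (case i of 0 \<Rightarrow> N | Suc i \<Rightarrow> N + m + i * P + n1)" for i
    define xs where "xs i = (case i of 0 \<Rightarrow> x | Suc i \<Rightarrow> z i)" for i
    have "\<exists>y\<in>X. \<forall>j<Suc R. \<forall>p\<le>b j - a j. dist ((T ^^ (p + a j)) y) ((T ^^ p) (xs j)) < \<eta>"
      by (rule m[rule_format]) (auto simp: a_def b_def xs_def x z P_def n0_def algebra_simps split: nat.splits)
    then obtain y where y: "y \<in> X" and
      sh: "\<And>j p. j < Suc R \<Longrightarrow> p \<le> b j - a j \<Longrightarrow> dist ((T ^^ (p + a j)) y) ((T ^^ p) (xs j)) < \<eta>"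
      by blast
    have shadow_x: "dist ((T ^^ p) y) ((T ^^ p) x) < \<delta>" if "p \<le> N" for p
      using sh[of 0 p] that \<eta>\<delta> by (simp add: a_def b_def xs_def)
    define w where "w = (T ^^ N) y"
    have w: "w \<in> X" using funpow_in[OF y] by (simp add: w_def)
    have shadow_z: "dist ((T ^^ p) ((T ^^ (m + i * P)) w)) ((T ^^ p) (z i)) < \<eta>" if "i < R" "p < n0" for i p
    proof -
      have "p + (N + m + i * P) = p + ((m + i * P) + N)" by simp
      then have "(T ^^ (p + (N + m + i * P))) y = (T ^^ p) ((T ^^ (m + i * P)) w)"
        by (simp only: funpow_add comp_apply w_def)
      then show ?thesis using sh[of "Suc i" p] that by (simp add: a_def b_def xs_def n0_def)
    qed
    have main: "\<bar>birk T (h j) n w\<bar> \<le> \<delta> * real n + real L" if j: "j < k" and n: "n \<le> R" for j n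
    proof -
      have block: "\<bar>birk T (h j) n0 ((T ^^ (m + i * P)) w) - birk T (h j) n0 (z i)\<bar> \<le> \<delta> / 4 * real n0"
        if "i < R" for i
        by (rule birk_diff_le, rule less_imp_le, rule d(2))
           (use shadow_z[OF that] \<eta>d[OF j] z w funpow_in in \<open>auto intro: less_le_trans\<close>)
      \<comment> \<open>Each period adds \<open>\<delta> / 4 * n0\<close> for shadowing the block
        and as much again for the gap behind it.\<close>
      have blocks: "\<bar>birk T (h j) (m + q * P) w - (\<Sum>i<q. birk T (h j) n0 (z i))\<bar>
          \<le> C * real m + real q * (\<delta> / 2 * real n0)" if "q \<le> R" for q
        using that
      proof (induction q)
        case 0
        then show ?case using birk_C[OF j w, of m] by simp
      next
        case (Suc q)
        define v where "v = (T ^^ (m + q * P)) w"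
        have v: "v \<in> X" using w funpow_in by (simp add: v_def)
        have "m + Suc q * P = (m + q * P) + (n0 + m)" by (simp add: P_def)
        then have "birk T (h j) (m + Suc q * P) w
            = birk T (h j) (m + q * P) w + (birk T (h j) n0 v + birk T (h j) m ((T ^^ n0) v))"
          by (simp only: birk_add v_def)
        moreover have "\<bar>birk T (h j) m ((T ^^ n0) v)\<bar> \<le> \<delta> / 4 * real n0"
          using birk_C[OF j funpow_in[OF v], of m n0] gap by linarith
        moreover have "\<bar>birk T (h j) n0 v - birk T (h j) n0 (z q)\<bar> \<le> \<delta> / 4 * real n0"
          using block[of q] Suc.prems by (simp add: v_def)
        moreover have "real (Suc q) * (\<delta> / 2 * real n0)
            = real q * (\<delta> / 2 * real n0) + \<delta> / 4 * real n0 + \<delta> / 4 * real n0"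
          by (simp add: field_simps)
        ultimately show ?case using Suc.IH[OF Suc_leD[OF Suc.prems]]
          unfolding sum.lessThan_Suc by linarith
      qed
      show ?thesis
      proof (cases "n \<le> m")
        case True
        have "\<bar>birk T (h j) n w\<bar> \<le> C * real n" by (rule birk_C[OF j w])
        also have "\<dots> \<le> C * real m" using True C0 by (intro mult_left_mono) auto
        also have "\<dots> \<le> real L"
        proof -
          have "0 \<le> A / (\<delta> / 4)" "0 \<le> C * real P" using A0 C0 \<delta> by auto
          then show ?thesis using L by linarith
        qed
        finally show ?thesis using \<delta> by (simp add: add_increasing)
      next
        case False
        define q where "q = (n - m) div P"
        define r where "r = (n - m) mod P"
        have P0: "P > 0" by (simp add: P_def n0_def)
        have n_eq: "n = (m + q * P) + r" using False by (simp add: q_def r_def)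
        have r: "r \<le> P" using P0 by (simp add: r_def less_imp_le)
        have "q * 1 \<le> q * P" using P0 by (intro mult_left_mono) auto
        then have qR: "q \<le> R" using n n_eq by linarith
        have qn: "real q * real n0 \<le> real n"
        proof -
          have "q * n0 \<le> n" using n_eq by (simp add: P_def algebra_simps)
          then show ?thesis by (metis of_nat_le_iff of_nat_mult)
        qed
        have "\<bar>\<Sum>i<q. birk T (h j) n0 (z i)\<bar> \<le> \<delta> / 4 * real q + A / (\<delta> / 4)"
          using zsum[OF j, of q] \<delta> A0 unfolding A_def[symmetric] by (intro abs_le_of_square_le) auto
        moreover have "\<delta> / 4 * real q \<le> \<delta> / 4 * (real q * real n0)"
          using \<delta> by (intro mult_left_mono) (auto simp: n0_def algebra_simps)
        moreover have "\<bar>birk T (h j) r ((T ^^ (m + q * P)) w)\<bar> \<le> C * real P"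
          using birk_C[OF j funpow_in[OF w], of r "m + q * P"] r C0
            mult_left_mono[of "real r" "real P" C] by linarith
        moreover have "birk T (h j) n w
            = birk T (h j) (m + q * P) w + birk T (h j) r ((T ^^ (m + q * P)) w)"
          unfolding n_eq by (rule birk_add)
        \<comment> \<open>Slope \<open>\<delta> / 4\<close> comes from the greedy bound and
          \<open>\<delta> / 2\<close> from the periods, leaving a quarter to spare.\<close>
        moreover have "\<delta> / 4 * (real q * real n0) + real q * (\<delta> / 2 * real n0) \<le> \<delta> * real n"
        proof -
          have "\<delta> / 4 * (real q * real n0) + real q * (\<delta> / 2 * real n0) = 3/4 * \<delta> * (real q * real n0)"
            by (simp add: field_simps)
          also have "\<dots> \<le> 1 * \<delta> * (real q * real n0)" using \<delta> by (intro mult_right_mono) auto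
          also have "\<dots> \<le> \<delta> * real n" using qn \<delta> by simp
          finally show ?thesis .
        qed
        ultimately show ?thesis using blocks[OF qR] L by linarith
      qed
    qed
    show "\<exists>y\<in>X. (\<forall>p\<le>N. dist ((T ^^ p) y) ((T ^^ p) x) < \<delta>) \<and>
       (\<forall>j<k. \<forall>n\<le>R. \<bar>birk T (h j) n ((T ^^ N) y)\<bar> \<le> \<delta> * real n + real L)"
      using y shadow_x main unfolding w_def by blast
  qed
qed

end

section \<open>Concatenating infinitely many stages\<close>

lemma between_strict_mono:
  fixes N :: "nat \<Rightarrow> nat"
  assumes "strict_mono N" "N K \<le> n"
  obtains k where "K \<le> k" "N k \<le> n" "n \<le> N (Suc k)"
proof -
  have "\<exists>k\<ge>K. N k \<le> n \<and> n < N (Suc k)"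
    using assms(2)
  proof (induction n rule: dec_induct)
    case base
    then show ?case using strict_monoD[OF assms(1), of K "Suc K"] by blast
  next
    case (step n)
    then obtain k where k: "k \<ge> K" "N k \<le> n" "n < N (Suc k)" by blast
    show ?case
    proof (cases "Suc n < N (Suc k)")
      case True
      then show ?thesis using k le_SucI by blast
    next
      case False
      then have "Suc n = N (Suc k)" using k by simp
      then show ?thesis using k strict_monoD[OF assms(1), of "Suc k" "Suc (Suc k)"]
        by (intro exI[of _ "Suc k"]) auto
    qed
  qed
  then show thesis using that less_imp_le by blast
qed

text \<open>By \<open>NL\<close> the overhead accumulated through stage \<open>k\<close> is at most
  \<open>N k / k\<close>, so it is negligible at all times of that stage, including its very
  beginning. Stages preceding the \<open>K\<close> that belongs to \<open>\<epsilon>\<close> enter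
  only through the constant \<open>D\<close>.\<close>

lemma blockwise_sublinear:
  fixes s :: "nat \<Rightarrow> real" and L N :: "nat \<Rightarrow> nat"
  assumes N: "strict_mono N" and NL: "\<And>k. k * (\<Sum>l\<le>k. L l) \<le> N k"
    and incr: "\<And>\<epsilon>. \<epsilon> > 0 \<Longrightarrow> \<exists>K. \<forall>k\<ge>K. \<forall>n. N k \<le> n \<and> n \<le> N (Suc k) \<longrightarrow>
        \<bar>s n - s (N k)\<bar> \<le> \<epsilon> * real (n - N k) + real (L k)"
  shows "(\<lambda>n. s n / real n) \<longlonglongrightarrow> 0"
proof (rule LIMSEQ_I)
  fix \<epsilon> :: real assume \<epsilon>: "\<epsilon> > 0"
  obtain K0 where K0: "\<And>k n. k \<ge> K0 \<Longrightarrow> N k \<le> n \<Longrightarrow> n \<le> N (Suc k) \<Longrightarrow>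
      \<bar>s n - s (N k)\<bar> \<le> \<epsilon> / 4 * real (n - N k) + real (L k)"
    using incr[of "\<epsilon> / 4"] \<epsilon> by (metis divide_pos_pos zero_less_numeral)
  \<comment> \<open>Shares of the final bound \<open>\<epsilon> * n\<close>: a quarter for the
    slope, a quarter for the overhead (from \<open>K1\<close> on), half for \<open>D\<close> (from
    \<open>n0\<close> on).\<close>
  obtain K1 :: nat where K1: "4 / \<epsilon> < real K1" by (rule exE[OF reals_Archimedean2])
  define K where "K = max K0 K1"
  define D where "D = \<bar>s (N K)\<bar>"
  have at_N: "\<bar>s (N k)\<bar> \<le> D + \<epsilon> / 4 * real (N k) + real (\<Sum>l<k. L l)" if "k \<ge> K" for k
    using that
  proof (induction k rule: nat_induct_at_least)
    case base
    then show ?case using \<epsilon> by (simp add: D_def sum_nonneg)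
  next
    case (Suc k)
    have le: "N k \<le> N (Suc k)" using strict_monoD[OF N, of k "Suc k"] by simp
    have "\<bar>s (N (Suc k)) - s (N k)\<bar> \<le> \<epsilon> / 4 * real (N (Suc k) - N k) + real (L k)"
      using K0[of k "N (Suc k)"] Suc le by (simp add: K_def)
    also have "real (N (Suc k) - N k) = real (N (Suc k)) - real (N k)" using le by (rule of_nat_diff)
    finally show ?case using Suc.IH by (simp add: algebra_simps)
  qed
  obtain n0 :: nat where n0: "2 * D / \<epsilon> < real n0" by (rule exE[OF reals_Archimedean2])
  show "\<exists>no. \<forall>n\<ge>no. norm (s n / real n - 0) < \<epsilon>"
  proof (intro exI[of _ "max (max n0 1) (N K)"] allI impI)
    fix n assume n: "max (max n0 1) (N K) \<le> n"
    then obtain k where k: "K \<le> k" "N k \<le> n" "n \<le> N (Suc k)"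
      using between_strict_mono[OF N, of K n] by auto
    have "\<bar>s n - s (N k)\<bar> \<le> \<epsilon> / 4 * real (n - N k) + real (L k)"
      using K0[of k n] k by (simp add: K_def)
    also have "real (n - N k) = real n - real (N k)" using k by (simp add: of_nat_diff)
    finally have 1: "\<bar>s n\<bar> \<le> D + \<epsilon> / 4 * real n + real (\<Sum>l\<le>k. L l)"
      using at_N[OF k(1)]
      unfolding lessThan_Suc_atMost[symmetric] sum.lessThan_Suc of_nat_add right_diff_distrib by linarith
    have "4 / \<epsilon> * real (\<Sum>l\<le>k. L l) \<le> real k * real (\<Sum>l\<le>k. L l)"
      using K1 k(1) by (intro mult_right_mono) (auto simp: K_def sum_nonneg)
    also have "\<dots> \<le> real n" using NL[of k] k(2) by (metis of_nat_mult of_nat_le_iff order_trans)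
    finally have "real (\<Sum>l\<le>k. L l) \<le> \<epsilon> / 4 * real n" using \<epsilon> by (simp add: field_simps)
    moreover have "D < \<epsilon> / 2 * real n"
    proof -
      have "D < \<epsilon> / 2 * real n0" using n0 \<epsilon> by (simp add: field_simps)
      also have "\<dots> \<le> \<epsilon> / 2 * real n" using n \<epsilon> by (intro mult_left_mono) auto
      finally show ?thesis .
    qed
    ultimately have "\<bar>s n\<bar> < \<epsilon> * real n" using 1 by linarith
    then show "norm (s n / real n - 0) < \<epsilon>" using n by (simp add: abs_divide pos_divide_less_eq)
  qed
qed

text \<open>The point is a limit of finite stages: \<open>x (Suc k)\<close> shadows
  \<open>x k\<close> up to time \<open>N k\<close> and then has controlled sums up to
  \<open>N (Suc k)\<close>. Tolerances are summable, so the limit stays close to every stage on the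
  whole range of times that the stage controls.\<close>

lemma (in compact_system) generic_point:
  fixes g :: "nat \<Rightarrow> 'a \<Rightarrow> real"
  assumes spec: "has_specification X T" and M: "M \<in> inv_measures X T"
    and g: "\<And>j. continuous_on X (g j)"
  obtains x where "x \<in> X" "\<And>j. (\<lambda>n. birk T (g j) n x / real n) \<longlonglongrightarrow> integral\<^sup>L M (g j)"
proof -
  interpret prob_space M using inv_measuresD[OF M] by blast
  define h where "h j x = g j x - integral\<^sup>L M (g j)" for j x
  have h: "continuous_on X (h j)" for j
    unfolding h_def by (intro continuous_intros g)
  have h0: "integral\<^sup>L M (h j) = 0" for j
    using integrable_cont[OF inv_measuresD(1,2)[OF M] g] by (simp add: h_def[abs_def] prob_space)
  define \<delta> :: "nat \<Rightarrow> real" where "\<delta> k = (1/2) ^ k" for k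
  have \<delta>: "\<delta> k > 0" "\<delta> (Suc k) = \<delta> k / 2" for k by (simp_all add: \<delta>_def)
  have "\<exists>L :: nat. \<forall>x\<in>X. \<forall>N R. \<exists>y\<in>X. (\<forall>p\<le>N. dist ((T ^^ p) y) ((T ^^ p) x) < \<delta> k) \<and>
       (\<forall>j<k. \<forall>n\<le>R. \<bar>birk T (h j) n ((T ^^ N) y)\<bar> \<le> \<delta> k * real n + real L)" for k
  proof (rule specification_step[where h = h and k = k, OF spec M h h0 \<delta>(1)[of k]])
    fix L :: nat
    assume "\<And>x N R. x \<in> X \<Longrightarrow> \<exists>y\<in>X. (\<forall>p\<le>N. dist ((T ^^ p) y) ((T ^^ p) x) < \<delta> k) \<and>
       (\<forall>j<k. \<forall>n\<le>R. \<bar>birk T (h j) n ((T ^^ N) y)\<bar> \<le> \<delta> k * real n + real L)"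
    then show ?thesis by blast
  qed
  then obtain L :: "nat \<Rightarrow> nat" where L: "\<And>k x N R. x \<in> X \<Longrightarrow>
      \<exists>y\<in>X. (\<forall>p\<le>N. dist ((T ^^ p) y) ((T ^^ p) x) < \<delta> k) \<and>
       (\<forall>j<k. \<forall>n\<le>R. \<bar>birk T (h j) n ((T ^^ N) y)\<bar> \<le> \<delta> k * real n + real (L k))" by metis
  \<comment> \<open>The factor \<open>k\<close> makes past overhead negligible; \<open>Suc\<close>
    makes \<open>N\<close> strictly increasing even where every \<open>L l\<close> is 0.\<close>
  define N where "N k = k * Suc (\<Sum>l\<le>k. L l)" for k
  have N: "strict_mono N"
  proof (rule strict_monoI_Suc)
    fix k show "N k < N (Suc k)" by (simp add: N_def algebra_simps)
  qed
  define R where "R k x y \<longleftrightarrow> (\<forall>p\<le>N k. dist ((T ^^ p) y) ((T ^^ p) x) < \<delta> k) \<and>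
       (\<forall>j<k. \<forall>n\<le>N (Suc k) - N k. \<bar>birk T (h j) n ((T ^^ N k) y)\<bar> \<le> \<delta> k * real n + real (L k))" for k x y
  define Y where "Y k x = (SOME y. y \<in> X \<and> R k x y)" for k x
  have "\<exists>y. y \<in> X \<and> R k x y" if "x \<in> X" for x k
    unfolding R_def using L[OF that] by blast
  then have "Y k x \<in> X \<and> R k x (Y k x)" if "x \<in> X" for x k
    unfolding Y_def by (rule someI_ex) (use that in blast)
  then have Y: "\<And>k x. x \<in> X \<Longrightarrow> Y k x \<in> X" and YR: "\<And>k x. x \<in> X \<Longrightarrow> R k x (Y k x)"
    by blast+
  obtain x0 where x0: "x0 \<in> X" using not_empty inv_measuresD(3)[OF M] by auto
  define x where "x = rec_nat x0 Y"
  have x_Suc: "x (Suc k) = Y k (x k)" for k by (simp add: x_def)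
  have x: "x k \<in> X" for k by (induction k) (simp_all add: x_Suc Y x0, simp add: x_def x0)
  \<comment> \<open>The subtracted term closes the induction, since \<open>\<delta> l\<close> equals
    \<open>2 * \<delta> l - 2 * \<delta> (Suc l)\<close>.\<close>
  have drift: "dist ((T ^^ p) (x l)) ((T ^^ p) (x k)) \<le> 2 * \<delta> k - 2 * \<delta> l" if "p \<le> N k" "k \<le> l" for p k l
    using that(2)
  proof (induction l rule: dec_induct)
    case (step l)
    have "N k \<le> N l" using N step by (simp add: strict_mono_less_eq)
    then have "dist ((T ^^ p) (x (Suc l))) ((T ^^ p) (x l)) < \<delta> l"
      using YR[OF x, of l l, unfolded R_def] that by (simp add: x_Suc)
    then show ?case
      using step dist_triangle[of "(T ^^ p) (x (Suc l))" "(T ^^ p) (x k)" "(T ^^ p) (x l)"] \<delta>(2)[of l]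
      by linarith
  qed simp
  obtain y r where y: "y \<in> X" and r: "strict_mono r" and lim: "(x \<circ> r) \<longlonglongrightarrow> y"
    using compact_X x unfolding compact_def by metis
  have close: "dist ((T ^^ p) y) ((T ^^ p) (x k)) \<le> 2 * \<delta> k" if "p \<le> N k" for p k
  proof (rule tendsto_upperbound)
    have "(\<lambda>i. (T ^^ p) (x (r i))) \<longlonglongrightarrow> (T ^^ p) y"
      using continuous_on_tendsto_compose[OF continuous_on_funpow lim y] x by simp
    then show "(\<lambda>i. dist ((T ^^ p) (x (r i))) ((T ^^ p) (x k))) \<longlonglongrightarrow> dist ((T ^^ p) y) ((T ^^ p) (x k))"
      by (intro tendsto_intros)
    show "\<forall>\<^sub>F i in sequentially. dist ((T ^^ p) (x (r i))) ((T ^^ p) (x k)) \<le> 2 * \<delta> k"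
      using eventually_ge_at_top[of k]
    proof eventually_elim
      case (elim i)
      then have "k \<le> r i" using seq_suble[OF r, of i] by linarith
      then show ?case using drift[OF that] \<delta>(1)[of "r i"] by (smt (verit))
    qed
  qed simp
  have "(\<lambda>n. birk T (h j) n y / real n) \<longlonglongrightarrow> 0" for j
  proof (rule blockwise_sublinear[OF N, of L])
    show "k * (\<Sum>l\<le>k. L l) \<le> N k" for k by (simp add: N_def)
    fix \<epsilon> :: real assume \<epsilon>: "\<epsilon> > 0"
    obtain d where d: "d > 0" "\<And>u v. u \<in> X \<Longrightarrow> v \<in> X \<Longrightarrow> dist u v < d \<Longrightarrow> \<bar>h j u - h j v\<bar> < \<epsilon> / 2"
      using cont_modulus[OF h, of "\<epsilon> / 2" j] \<epsilon> half_gt_zero by blast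
    have "\<delta> \<longlonglongrightarrow> 0" unfolding \<delta>_def by (rule LIMSEQ_power_zero) simp
    then have "\<forall>\<^sub>F k in sequentially. \<delta> k < min d (\<epsilon> / 2)"
      using d(1) \<epsilon> by (intro order_tendstoD) auto
    then obtain K0 where K0: "\<And>k. k \<ge> K0 \<Longrightarrow> \<delta> k < min d (\<epsilon> / 2)"
      by (auto simp: eventually_sequentially)
    show "\<exists>K. \<forall>k\<ge>K. \<forall>n. N k \<le> n \<and> n \<le> N (Suc k) \<longrightarrow>
        \<bar>birk T (h j) n y - birk T (h j) (N k) y\<bar> \<le> \<epsilon> * real (n - N k) + real (L k)"
    \<comment> \<open>\<open>Suc j\<close> ensures \<open>j < k\<close>, so that \<open>h j\<close>
      is among the functions treated in stage \<open>k\<close>. The comparison is with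
      \<open>x (Suc k)\<close>, because the limit is close to it up to time
      \<open>N (Suc k)\<close>, within \<open>2 * \<delta> (Suc k) = \<delta> k\<close>.\<close>
    proof (intro exI[of _ "max K0 (Suc j)"] allI impI)
      fix k n assume k: "max K0 (Suc j) \<le> k" and n: "N k \<le> n \<and> n \<le> N (Suc k)"
      let ?u = "(T ^^ N k) y" and ?v = "(T ^^ N k) (x (Suc k))" and ?n = "n - N k"
      have uv: "?u \<in> X" "?v \<in> X" using funpow_in y x by auto
      have "dist ((T ^^ i) ?u) ((T ^^ i) ?v) < d" if "i < ?n" for i
      proof -
        have "i + N k \<le> N (Suc k)" using that n by linarith
        then have "dist ((T ^^ (i + N k)) y) ((T ^^ (i + N k)) (x (Suc k))) \<le> \<delta> k"
          using close[of "i + N k" "Suc k"] \<delta>(2)[of k] by simp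
        then show ?thesis using K0[of k] k by (simp add: funpow_add)
      qed
      then have 1: "\<bar>birk T (h j) ?n ?u - birk T (h j) ?n ?v\<bar> \<le> \<epsilon> / 2 * real ?n"
        by (intro birk_diff_le less_imp_le d(2) funpow_in uv) auto
      have "\<bar>birk T (h j) ?n ?v\<bar> \<le> \<delta> k * real ?n + real (L k)"
        using YR[OF x, of k k, unfolded R_def, THEN conjunct2, rule_format, of j ?n] k n
          diff_le_mono[of n "N (Suc k)" "N k"]
        by (simp add: x_Suc del: of_nat_diff)
      also have "\<dots> \<le> \<epsilon> / 2 * real ?n + real (L k)"
        using K0[of k] k by (intro add_right_mono mult_right_mono) auto
      finally have 2: "\<bar>birk T (h j) ?n ?v\<bar> \<le> \<epsilon> / 2 * real ?n + real (L k)" .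
      have "birk T (h j) n y = birk T (h j) (N k) y + birk T (h j) ?n ?u"
        using birk_add[of T "h j" "N k" ?n y] n by simp
      moreover have "\<epsilon> * real ?n = \<epsilon> / 2 * real ?n + \<epsilon> / 2 * real ?n" by simp
      ultimately show "\<bar>birk T (h j) n y - birk T (h j) (N k) y\<bar> \<le> \<epsilon> * real ?n + real (L k)"
        using 1 2 by linarith
    qed
  qed
  from tendsto_add[OF this tendsto_const]
  have lim0: "(\<lambda>n. birk T (h j) n y / real n + integral\<^sup>L M (g j)) \<longlonglongrightarrow> integral\<^sup>L M (g j)" for j
    by simp
  have "(\<lambda>n. birk T (g j) n y / real n) \<longlonglongrightarrow> integral\<^sup>L M (g j)" for j
  proof (rule Lim_transform_eventually[OF lim0])
    show "\<forall>\<^sub>F n in sequentially. birk T (h j) n y / real n + integral\<^sup>L M (g j) = birk T (g j) n y / real n"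
      using eventually_gt_at_top[of 0]
      by eventually_elim (simp add: birk_def h_def sum_subtractf field_simps)
  qed
  with y show thesis by (rule that)
qed

text \<open>One point must serve both potentials, lying in a level set of \<open>\<phi>\<close>
  while realising the value of \<open>f\<close>. The two countable families are therefore
  interleaved by parity before a generic point is taken.\<close>

lemma (in compact_system) inv_measure_realised:
  assumes spec: "has_specification X T" and f: "AAP X T f" and \<phi>: "AAP X T \<phi>"
    and M: "M \<in> inv_measures X T"
  obtains x where "x \<in> X" "(\<lambda>n. f n x / real n) \<longlonglongrightarrow> Fstar f M"
    "(\<lambda>n. \<phi> n x / real n) \<longlonglongrightarrow> Fstar \<phi> M"
proof -
  obtain G :: "nat \<Rightarrow> 'a \<Rightarrow> real" where G: "\<And>i. continuous_on X (G i)" "approximable (range G) f"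
    using AAP_countably_approximable[OF f] by blast
  obtain H :: "nat \<Rightarrow> 'a \<Rightarrow> real" where H: "\<And>i. continuous_on X (H i)" "approximable (range H) \<phi>"
    using AAP_countably_approximable[OF \<phi>] by blast
  define g where "g j = (if even j then G (j div 2) else H (j div 2))" for j
  have g: "continuous_on X (g j)" for j using G(1) H(1) by (simp add: g_def)
  obtain x where x: "x \<in> X" "\<And>j. (\<lambda>n. birk T (g j) n x / real n) \<longlonglongrightarrow> integral\<^sup>L M (g j)"
    by (rule generic_point[OF spec M g]) (rule that)
  have "(\<lambda>n. birk T (G i) n x / real n) \<longlonglongrightarrow> integral\<^sup>L M (G i)" for i
    using x(2)[of "2 * i"] by (simp add: g_def)
  moreover have "(\<lambda>n. birk T (H i) n x / real n) \<longlonglongrightarrow> integral\<^sup>L M (H i)" for i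
    using x(2)[of "Suc (2 * i)"] by (simp add: g_def)
  ultimately show thesis
    using orbit_average_LIMSEQ[OF M f G(2) x(1) filterlim_ident]
      orbit_average_LIMSEQ[OF M \<phi> H(2) x(1) filterlim_ident] that[OF x(1)] by blast
qed

theorem theoremC:
  fixes X :: "'a::metric_space set" and T :: "'a \<Rightarrow> 'a"
    and f \<phi> :: "nat \<Rightarrow> 'a \<Rightarrow> real" and \<alpha> :: real
  assumes "compact X" "X \<noteq> {}" "T ` X \<subseteq> X" "continuous_on X T"
    and "has_specification X T"
    and "AAP X T f" "AAP X T \<phi>"
    and "\<alpha> \<in> {eta_pot X T \<phi> .. beta_pot X T \<phi>}"
  shows "Lambda_cond X T f \<phi> \<alpha>
           = (SUP x\<in>level_set X \<phi> \<alpha>. limsup (\<lambda>n. ereal (f n x / real n)))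
         \<and> Lambda_cond X T f \<phi> \<alpha>
           = Sup {ereal (Fstar f M) | M. \<exists>x\<in>level_set X \<phi> \<alpha>. M \<in> emp_limits X T x}"
proof -
  interpret compact_system X T using assms by unfold_locales
  \<comment> \<open>Both equalities follow from the cycle of inequalities \<open>Lambda_cond\<close>
    \<le> \<open>?S\<close> \<le> \<open>?V\<close> \<le> \<open>Lambda_cond\<close>; specification
    enters only in the first.\<close>
  let ?S = "SUP x\<in>level_set X \<phi> \<alpha>. limsup (\<lambda>n. ereal (f n x / real n))"
  let ?V = "Sup {ereal (Fstar f M) | M. \<exists>x\<in>level_set X \<phi> \<alpha>. M \<in> emp_limits X T x}"
  have X: "x \<in> X" if "x \<in> level_set X \<phi> \<alpha>" for x using that by (simp add: level_set_def)
  have 1: "Lambda_cond X T f \<phi> \<alpha> \<le> ?S"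
    unfolding Lambda_cond_def
  proof (rule Sup_least, clarify)
    fix M assume M: "M \<in> inv_measures X T" and \<alpha>: "\<alpha> = Fstar \<phi> M"
    obtain x where x: "x \<in> X" "(\<lambda>n. f n x / real n) \<longlonglongrightarrow> Fstar f M"
      "(\<lambda>n. \<phi> n x / real n) \<longlonglongrightarrow> Fstar \<phi> M"
      using inv_measure_realised[OF assms(5-7) M] by blast
    have "x \<in> level_set X \<phi> (Fstar \<phi> M)" using x by (simp add: level_set_def)
    moreover have "limsup (\<lambda>n. ereal (f n x / real n)) = ereal (Fstar f M)"
      using x(2) by (intro lim_imp_Limsup) (auto intro: tendsto_ereal)
    ultimately show "ereal (Fstar f M) \<le> (SUP x\<in>level_set X \<phi> (Fstar \<phi> M). limsup (\<lambda>n. ereal (f n x / real n)))"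
      by (simp add: SUP_upper2)
  qed
  have 2: "?S \<le> ?V"
  proof (rule SUP_least)
    fix x assume x: "x \<in> level_set X \<phi> \<alpha>"
    obtain M where "M \<in> emp_limits X T x" "limsup (\<lambda>n. ereal (f n x / real n)) = ereal (Fstar f M)"
      using limsup_eq_Fstar[OF X[OF x] assms(6)] by blast
    then show "limsup (\<lambda>n. ereal (f n x / real n)) \<le> ?V" using x by (intro Sup_upper) auto
  qed
  have 3: "?V \<le> Lambda_cond X T f \<phi> \<alpha>"
    unfolding Lambda_cond_def
  proof (rule Sup_subset_mono, clarify)
    fix x M assume x: "x \<in> level_set X \<phi> \<alpha>" and M: "M \<in> emp_limits X T x"
    show "\<exists>M'. ereal (Fstar f M) = ereal (Fstar f M') \<and> M' \<in> inv_measures X T \<and> Fstar \<phi> M' = \<alpha>"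
      using emp_limits_invariant[OF X[OF x] M] emp_limits_level_set[OF x M assms(7)] by blast
  qed
  show ?thesis using 1 2 3 by (auto intro: order_antisym order_trans)
qed

end
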